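(* Let $\mathscr T=(V,\mathcal E)$ be the directed Cartesian product of locally finite rooted directed trees $\mathscr T_1,\ldots,\mathscr T_d$, of finite joint branching index, and let $(\mathscr M_z,\mathscr H_{\mathfrak c_a}(\mathscr T))$ be the analytic model of the Drury-Arveson-type multishift $S_{\boldsymbol\lambda_{\mathfrak c_a}}$ on $\mathscr T$. If $a$ is a positive integer such that $a\geq d$, then $\mathscr H_{\mathfrak c_a}(\mathscr T)$ admits the representing measure $\rho_{\mathscr T}\times\nu_{\mathscr T}=(\rho_u\times\nu_u)_{u\in\Omega_F,F\in\mathscr P}$. In this case, for $u\in\Omega_F$ and $F\in\mathscr P$, the positive scalar-valued measures $\rho_u$ and $\nu_u$ are given by $$d\rho_u(s)=\begin{cases}w_{|\mathsf d_u|}(s)\,dm(s)&\text{if }a>d,\\ d\delta_1(s)&\text{if }a=d,\end{cases}\qquad d\nu_u(z)=\frac{|z^{\mathsf d_u}|^2}{\|z^{\mathsf d_u}\|^2_{L^2(\partial\mathbb B^d,\sigma)}}\,d\sigma(z),$$ where $m$ is the Lebesgue measure on $[0,1]$, $\delta_1$ is the Borel probability measure supported at $\{1\}$, $\sigma$ is the normalized surface area measure on $\partial\mathbb B^d$, and $$w_l(s)=(l+d)\cdots(l+a-1)\sum_{i=d}^{a-1}\frac{s^{i+l-1}}{\prod_{d\leq j\neq i\leq a-1}(j-i)},\quad s\in[0,1],\ l\in\mathbb N.$$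
   Context: Conventions: $\mathbb N=\{0,1,2,\ldots\}$; for $\alpha\in\mathbb N^d$, $\alpha!=\prod_j\alpha_j!$ and $|\alpha|=\sum_j\alpha_j$; empty products are $1$. $\mathscr P$ is the set of all subsets of $\{1,\ldots,d\}$. $\mathbb B^d$ and $\partial\mathbb B^d$ are the unit ball and unit sphere of $\mathbb C^d$. Trees: a rooted directed tree is a connected directed graph without circuits in which every vertex has at most one parent and exactly one vertex (the root) has no parent. $\mathsf{Chi}(u)$ is the set of children of $u$; for a non-root $u$, $\mathsf{par}(u)$ is its parent and $\mathsf{sib}(u)=\mathsf{Chi}(\mathsf{par}(u))$ (so $u\in\mathsf{sib}(u)$). All directed trees are assumed countably infinite and leafless (every vertex has at least one child). Locally finite: every $\mathsf{Chi}(u)$ is finite. The depth of $u$ is the length of the path from the root to $u$. Products: for rooted directed trees $\mathscr T_j=(V_j,\mathcal E_j)$ with roots $\mathsf{root}_j$, the directed Cartesian product $\mathscr T=(V,\mathcal E)$ has $V=V_1\times\cdots\times V_d$ and $(v,w)\in\mathcal E$ iff there is $k$ with $v_j=w_j$ for $j\neq k$ and $(v_k,w_k)\in\mathcal E_k$. Put $\mathsf{root}=(\mathsf{root}_1,\ldots,\mathsf{root}_d)$. The depth of $v\in V$ is $\mathsf d_v=(\mathsf d_{v_1},\ldots,\mathsf d_{v_d})$, $\mathsf d_{v_j}$ being the depth of $v_j$ in $\mathscr T_j$. $\mathsf{Chi}_j(v)$ (resp. $\mathsf{sib}_j(v)$, for $v_j\neq\mathsf{root}_j$) is the set of $w\in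 V$ with $w_i=v_i$ for $i\ne j$ and $w_j\in\mathsf{Chi}(v_j)$ (resp. $w_j\in\mathsf{sib}(v_j)$). $\mathscr T$ is of finite joint branching index if, for each $j$, the set of depths of the branching vertices of $\mathscr T_j$ (vertices with at least two children) is bounded (possibly empty). Drury-Arveson-type multishift: for $a>0$ put $\lambda_j(w)=\frac{1}{\sqrt{\mathrm{card}(\mathsf{Chi}_j(v))}}\sqrt{\frac{\mathsf d_{v_j}+1}{|\mathsf d_v|+a}}$ for $w\in\mathsf{Chi}_j(v)$, $v\in V$, $j=1,\ldots,d$. On $l^2(V)$ with orthonormal basis $\{e_v\}_{v\in V}$ of indicator functions, $S_{\boldsymbol\lambda_{\mathfrak c_a}}=(S_1,\ldots,S_d)$ is the bounded commuting multishift $S_je_v=\sum_{w\in\mathsf{Chi}_j(v)}\lambda_j(w)e_w$. Put $E=\bigcap_{j=1}^d\ker S_j^*$. Spaces $\mathcal L_{u,F}$: for $F\in\mathscr P$ let $\Phi_F=\{v\in V: v_j\neq\mathsf{root}_j\text{ if }j\in F,\ v_j=\mathsf{root}_j\text{ if }j\notin F\}$. For $u\in\Phi_F$, $\mathsf{sib}_F(u)$ is the set of $w\in V$ with $w_j\in\mathsf{sib}(u_j)$ for $j\in F$ and $w_j=u_j$ for $j\notin F$. These sets partition $\Phi_F$, and $\Omega_F$ is any set containing exactly one element of each class. For $G\in\mathscr P$, $v_G$ is $v$ with all coordinates $v_j$, $j\notin G$, replaced by $\mathsf{root}_j$; $\mathsf{sib}_{F,G}(u)=\{v_G: v\in\mathsf{sib}_F(u)\}$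 for $G\subseteq F$; for $j\notin G$, $v_G|u_j$ is $v_G$ with $j$-th coordinate replaced by $u_j$. $\mathcal L_{u,F}\subseteq l^2(\mathsf{sib}_F(u))$ is the space of $f$ with $\sum_{w\in\mathsf{sib}_j(v_G|u_j)}f(w)\lambda_j(w)=0$ for all $j\in F$, $G=F\setminus\{j\}$, $v_G\in\mathsf{sib}_{F,G}(u)$ ($\mathcal L_{\mathsf{root},\emptyset}$ is the span of $e_{\mathsf{root}}$). One has $E=\bigoplus_{F\in\mathscr P}\bigoplus_{u\in\Omega_F}\mathcal L_{u,F}$, and $E$ is finite dimensional under finite joint branching index. Analytic model: $\mathscr H_{\mathfrak c_a}(\mathscr T)$ is the Hilbert space of $E$-valued power series $f(z)=\sum_{\alpha\in\mathbb N^d}f_\alpha z^\alpha$, $f_\alpha\in E$, with $\|f\|^2=\sum_\alpha\|S_{\boldsymbol\lambda_{\mathfrak c_a}}^\alpha f_\alpha\|^2_{l^2(V)}<\infty$ (holomorphic functions on $\mathbb B^d$), and $\mathscr M_z$ is the $d$-tuple of multiplications by coordinate functions, unitarily equivalent to $S_{\boldsymbol\lambda_{\mathfrak c_a}}$. $E$ is identified with the constant functions. Representing measure: a Hilbert space $\mathscr H$ of this kind admits a representing measure if there exists a $B(E)$-valued product measure $\rho_{\mathscr T}\times\nu_{\mathscr T}=(\rho_u\times\nu_u)_{u\in\Omega_F,F\in\mathscr P}$ supported on $[0,b]\times\partial\mathbb B^d$, $b>0$, such that: (1) for any $f\in E$ and $\alpha\in\mathbb N^d$, $\|z^\alpha f\|^2_{\mathscr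 H}=\int_{[0,b]}\int_{\partial\mathbb B^d}s^{|\alpha|}|z^\alpha|^2\langle d\rho_{\mathscr T}(s)\times d\nu_{\mathscr T}(z)f,f\rangle$; (2) $\rho_u$ and $\nu_u$ are scalar-valued measures such that for $g_{u,F}\in\mathcal L_{u,F}$, $d\rho_{\mathscr T}(s)\times d\nu_{\mathscr T}(z)\big(\sum_F\sum_{u\in\Omega_F}g_{u,F}\big)=\sum_F\sum_{u\in\Omega_F}d\rho_u(s)\,d\nu_u(z)\,g_{u,F}$; (3) $\rho_{\mathsf{root}}$ and $\nu_{\mathsf{root}}$ are probability measures. *)

theory Defs
  imports "HOL-Probability.Probability"
begin

section \<open>Directed trees\<close>

record 'v digraph =
  verts :: "'v set"
  edges :: "('v \<times> 'v) set"

definition Chi :: "'v digraph \<Rightarrow> 'v \<Rightarrow> 'v set" where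
  "Chi G u = {w. (u, w) \<in> edges G}"

text \<open>Connectedness is that of the underlying undirected graph; \<open>acyclic\<close> excludes all directed
  circuits, loops included.\<close>

definition rooted_directed_tree :: "'v digraph \<Rightarrow> bool" where
  "rooted_directed_tree G \<longleftrightarrow>
     edges G \<subseteq> verts G \<times> verts G \<and>
     (\<forall>u\<in>verts G. \<forall>v\<in>verts G. (u, v) \<in> (edges G \<union> (edges G)\<inverse>)\<^sup>*) \<and>
     acyclic (edges G) \<and>
     (\<forall>v\<in>verts G. \<exists>\<^sub>\<le>\<^sub>1u. (u, v) \<in> edges G) \<and>
     (\<exists>!r. r \<in> verts G \<and> (\<forall>u. (u, r) \<notin> edges G))"

definition leafless :: "'v digraph \<Rightarrow> bool" where
  "leafless G \<longleftrightarrow> (\<forall>u\<in>verts G. Chi G u \<noteq> {})"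

definition locally_finite :: "'v digraph \<Rightarrow> bool" where
  "locally_finite G \<longleftrightarrow> (\<forall>u\<in>verts G. finite (Chi G u))"

definition troot :: "'v digraph \<Rightarrow> 'v" where
  "troot G = (THE r. r \<in> verts G \<and> (\<forall>u. (u, r) \<notin> edges G))"

definition par :: "'v digraph \<Rightarrow> 'v \<Rightarrow> 'v" where
  "par G v = (THE u. (u, v) \<in> edges G)"

definition sib :: "'v digraph \<Rightarrow> 'v \<Rightarrow> 'v set" where
  "sib G v = Chi G (par G v)"

definition depth :: "'v digraph \<Rightarrow> 'v \<Rightarrow> nat" where
  "depth G v = (THE n. (troot G, v) \<in> edges G ^^ n)"

definition branching :: "'v digraph \<Rightarrow> 'v set" where
  "branching G = {v \<in> verts G. \<exists>x\<in>Chi G v. \<exists>y\<in>Chi G v. x \<noteq> y}"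


section \<open>Directed Cartesian products\<close>

text \<open>The factors are indexed by a finite type \<open>'n\<close>, so that \<open>d = CARD('n)\<close> and
  \<open>\<complex>\<^sup>d\<close> is \<^typ>\<open>complex ^ 'n\<close>; multi-indices have type \<^typ>\<open>'n \<Rightarrow> nat\<close>.\<close>

definition dprod :: "('n \<Rightarrow> 'v digraph) \<Rightarrow> ('n \<Rightarrow> 'v) digraph" where
  "dprod T =
     \<lparr>verts = {v. \<forall>j. v j \<in> verts (T j)},
      edges = {(v, w). (\<forall>j. v j \<in> verts (T j)) \<and> (\<forall>j. w j \<in> verts (T j)) \<and>
                (\<exists>k. (\<forall>j. j \<noteq> k \<longrightarrow> v j = w j) \<and> (v k, w k) \<in> edges (T k))}\<rparr>"

definition finite_joint_branching_index :: "('n \<Rightarrow> 'v digraph) \<Rightarrow> bool" where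
  "finite_joint_branching_index T \<longleftrightarrow> (\<forall>j. bdd_above (depth (T j) ` branching (T j)))"

definition droot :: "('n \<Rightarrow> 'v digraph) \<Rightarrow> 'n \<Rightarrow> 'v" where
  "droot T = (\<lambda>j. troot (T j))"

definition mdepth :: "('n \<Rightarrow> 'v digraph) \<Rightarrow> ('n \<Rightarrow> 'v) \<Rightarrow> 'n \<Rightarrow> nat" where
  "mdepth T v = (\<lambda>j. depth (T j) (v j))"

definition mabs :: "('n::finite \<Rightarrow> nat) \<Rightarrow> nat" where
  "mabs \<alpha> = (\<Sum>j\<in>UNIV. \<alpha> j)"

definition Chi_at :: "('n \<Rightarrow> 'v digraph) \<Rightarrow> 'n \<Rightarrow> ('n \<Rightarrow> 'v) \<Rightarrow> ('n \<Rightarrow> 'v) set" where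
  "Chi_at T j v = {w \<in> verts (dprod T). (\<forall>i. i \<noteq> j \<longrightarrow> w i = v i) \<and> w j \<in> Chi (T j) (v j)}"

definition sib_at :: "('n \<Rightarrow> 'v digraph) \<Rightarrow> 'n \<Rightarrow> ('n \<Rightarrow> 'v) \<Rightarrow> ('n \<Rightarrow> 'v) set" where
  "sib_at T j v = {w \<in> verts (dprod T). (\<forall>i. i \<noteq> j \<longrightarrow> w i = v i) \<and> w j \<in> sib (T j) (v j)}"


section \<open>Square-summable functions\<close>

definition ell2 :: "'x set \<Rightarrow> ('x \<Rightarrow> complex) set" where
  "ell2 V = {f. (\<forall>x. x \<notin> V \<longrightarrow> f x = 0) \<and> (\<lambda>x. (cmod (f x))\<^sup>2) summable_on V}"

definition ell2_inner :: "'x set \<Rightarrow> ('x \<Rightarrow> complex) \<Rightarrow> ('x \<Rightarrow> complex) \<Rightarrow> complex" where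
  "ell2_inner V f g = (\<Sum>\<^sub>\<infinity>x\<in>V. f x * cnj (g x))"

definition ell2_norm :: "'x set \<Rightarrow> ('x \<Rightarrow> complex) \<Rightarrow> real" where
  "ell2_norm V f = sqrt (\<Sum>\<^sub>\<infinity>x\<in>V. (cmod (f x))\<^sup>2)"

definition ell2_adjoint ::
  "'x set \<Rightarrow> (('x \<Rightarrow> complex) \<Rightarrow> ('x \<Rightarrow> complex)) \<Rightarrow> ('x \<Rightarrow> complex) \<Rightarrow> ('x \<Rightarrow> complex)" where
  "ell2_adjoint V A g =
     (THE h. h \<in> ell2 V \<and> (\<forall>f\<in>ell2 V. ell2_inner V (A f) g = ell2_inner V f h))"

text \<open>\<open>A\<^sup>\<alpha> = \<Prod>\<^sub>j A\<^sub>j\<^bsup>\<alpha>\<^sub>j\<^esup>\<close>. The fold is meaningful for commuting tuples only, where the order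
  of the factors does not matter; both tuples it is applied to below commute.\<close>

definition tuple_power :: "('n::finite \<Rightarrow> 'b \<Rightarrow> 'b) \<Rightarrow> ('n \<Rightarrow> nat) \<Rightarrow> 'b \<Rightarrow> 'b" where
  "tuple_power A \<alpha> = Finite_Set.fold (\<lambda>j B. (A j ^^ \<alpha> j) \<circ> B) id UNIV"


section \<open>The Drury-Arveson-type multishift\<close>

definition da_weight :: "('n::finite \<Rightarrow> 'v digraph) \<Rightarrow> real \<Rightarrow> 'n \<Rightarrow> ('n \<Rightarrow> 'v) \<Rightarrow> real" where
  "da_weight T a j w =
     (let v = w(j := par (T j) (w j)) in
       1 / sqrt (real (card (Chi_at T j v))) *
       sqrt ((real (mdepth T v j) + 1) / (real (mabs (mdepth T v)) + a)))"

text \<open>The \<open>j\<close>-th shift is the linear extension of its action on the basis \<open>e\<^sub>v\<close> of indicator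
  functions, \<open>S\<^sub>j f = \<Sum>\<^sub>v f(v) S\<^sub>j e\<^sub>v\<close>. The sum is taken pointwise, and at each point at most one
  term is nonzero.\<close>

definition multishift ::
  "('n::finite \<Rightarrow> 'v digraph) \<Rightarrow> real \<Rightarrow> 'n \<Rightarrow> (('n \<Rightarrow> 'v) \<Rightarrow> complex) \<Rightarrow> (('n \<Rightarrow> 'v) \<Rightarrow> complex)" where
  "multishift T a j f =
     (\<lambda>x. \<Sum>\<^sub>\<infinity>v\<in>verts (dprod T).
        f v * (\<Sum>w\<in>Chi_at T j v. complex_of_real (da_weight T a j w) * indicator {w} x))"

lemma multishift_basis:
  assumes "v \<in> verts (dprod T)"
  shows "multishift T a j (indicator {v}) =
    (\<lambda>x. \<Sum>w\<in>Chi_at T j v. complex_of_real (da_weight T a j w) * indicator {w} x)"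
proof
  fix x
  let ?s = "\<lambda>u. \<Sum>w\<in>Chi_at T j u. complex_of_real (da_weight T a j w) * indicator {w} x"
  have "(\<Sum>\<^sub>\<infinity>u\<in>verts (dprod T). indicator {v} u * ?s u) = (\<Sum>\<^sub>\<infinity>u\<in>{v}. indicator {v} u * ?s u)"
    using assms by (intro infsum_cong_neutral) auto
  then show "multishift T a j (indicator {v}) x = ?s v"
    by (simp add: multishift_def)
qed

definition joint_kernel :: "('n::finite \<Rightarrow> 'v digraph) \<Rightarrow> real \<Rightarrow> (('n \<Rightarrow> 'v) \<Rightarrow> complex) set" where
  "joint_kernel T a =
     {f \<in> ell2 (verts (dprod T)).
        \<forall>j. ell2_adjoint (verts (dprod T)) (multishift T a j) f = (\<lambda>_. 0)}"


section \<open>The spaces \<open>\<L>\<^bsub>u,F\<^esub>\<close>\<close>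

definition Phi :: "('n \<Rightarrow> 'v digraph) \<Rightarrow> 'n set \<Rightarrow> ('n \<Rightarrow> 'v) set" where
  "Phi T F = {v \<in> verts (dprod T).
     (\<forall>j\<in>F. v j \<noteq> troot (T j)) \<and> (\<forall>j. j \<notin> F \<longrightarrow> v j = troot (T j))}"

definition sibF :: "('n \<Rightarrow> 'v digraph) \<Rightarrow> 'n set \<Rightarrow> ('n \<Rightarrow> 'v) \<Rightarrow> ('n \<Rightarrow> 'v) set" where
  "sibF T F u = {w \<in> verts (dprod T).
     (\<forall>j\<in>F. w j \<in> sib (T j) (u j)) \<and> (\<forall>j. j \<notin> F \<longrightarrow> w j = u j)}"

definition transversals :: "('n \<Rightarrow> 'v digraph) \<Rightarrow> ('n set \<Rightarrow> ('n \<Rightarrow> 'v) set) \<Rightarrow> bool" where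
  "transversals T \<Omega> \<longleftrightarrow>
     (\<forall>F. \<Omega> F \<subseteq> Phi T F \<and> (\<forall>u\<in>Phi T F. \<exists>!w. w \<in> \<Omega> F \<and> w \<in> sibF T F u))"

definition coord_restrict :: "('n \<Rightarrow> 'v digraph) \<Rightarrow> 'n set \<Rightarrow> ('n \<Rightarrow> 'v) \<Rightarrow> ('n \<Rightarrow> 'v)" where
  "coord_restrict T G v = (\<lambda>j. if j \<in> G then v j else troot (T j))"

definition sibFG :: "('n \<Rightarrow> 'v digraph) \<Rightarrow> 'n set \<Rightarrow> 'n set \<Rightarrow> ('n \<Rightarrow> 'v) \<Rightarrow> ('n \<Rightarrow> 'v) set" where
  "sibFG T F G u = coord_restrict T G ` sibF T F u"

definition Lspace ::
  "('n::finite \<Rightarrow> 'v digraph) \<Rightarrow> real \<Rightarrow> ('n \<Rightarrow> 'v) \<Rightarrow> 'n set \<Rightarrow> (('n \<Rightarrow> 'v) \<Rightarrow> complex) set" where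
  "Lspace T a u F =
     {f \<in> ell2 (sibF T F u).
        \<forall>j\<in>F. \<forall>x\<in>sibFG T F (F - {j}) u.
          (\<Sum>w\<in>sib_at T j (x(j := u j)). f w * complex_of_real (da_weight T a j w)) = 0}"


section \<open>The analytic model\<close>

text \<open>An \<open>E\<close>-valued power series \<open>\<Sum>\<^sub>\<alpha> f\<^sub>\<alpha> z\<^sup>\<alpha>\<close> is represented by its coefficient family
  \<open>\<alpha> \<mapsto> f\<^sub>\<alpha>\<close>; multiplication by \<open>z\<^sub>j\<close> then shifts the family in direction \<open>j\<close>.\<close>

type_synonym ('n, 'v) vseries = "('n \<Rightarrow> nat) \<Rightarrow> ('n \<Rightarrow> 'v) \<Rightarrow> complex"

definition model_space :: "('n::finite \<Rightarrow> 'v digraph) \<Rightarrow> real \<Rightarrow> ('n, 'v) vseries set" where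
  "model_space T a =
     {f. (\<forall>\<alpha>. f \<alpha> \<in> joint_kernel T a) \<and>
         (\<lambda>\<alpha>. (ell2_norm (verts (dprod T)) (tuple_power (multishift T a) \<alpha> (f \<alpha>)))\<^sup>2) summable_on UNIV}"

definition model_norm :: "('n::finite \<Rightarrow> 'v digraph) \<Rightarrow> real \<Rightarrow> ('n, 'v) vseries \<Rightarrow> real" where
  "model_norm T a f =
     sqrt (\<Sum>\<^sub>\<infinity>\<alpha>. (ell2_norm (verts (dprod T)) (tuple_power (multishift T a) \<alpha> (f \<alpha>)))\<^sup>2)"

definition Mz :: "'n \<Rightarrow> ('n, 'v) vseries \<Rightarrow> ('n, 'v) vseries" where
  "Mz j f = (\<lambda>\<alpha>. if \<alpha> j = 0 then (\<lambda>_. 0) else f (\<alpha>(j := \<alpha> j - 1)))"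

definition const_series :: "(('n \<Rightarrow> 'v) \<Rightarrow> complex) \<Rightarrow> ('n, 'v) vseries" where
  "const_series f = (\<lambda>\<alpha>. if \<alpha> = (\<lambda>_. 0) then f else (\<lambda>_. 0))"


section \<open>Measures\<close>

definition zpow :: "complex ^ 'n::finite \<Rightarrow> ('n \<Rightarrow> nat) \<Rightarrow> complex" where
  "zpow z \<alpha> = (\<Prod>j\<in>UNIV. (z $ j) ^ \<alpha> j)"

text \<open>The normalized surface area measure of the unit sphere, in polar coordinates: a set \<open>A\<close> has
  measure \<open>vol {x. 0 < \<bar>x\<bar> < 1 \<and> x / \<bar>x\<bar> \<in> A} / vol (ball 0 1)\<close>. It is regarded as a Borel measure
  on the whole space which is concentrated on the sphere.\<close>

definition sphere_measure :: "(complex ^ 'n::finite) measure" where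
  "sphere_measure = distr (uniform_measure lborel (ball 0 1)) borel sgn"

text \<open>Values of a \<open>B(E)\<close>-valued measure matter on \<open>E\<close> only. Countable additivity is in the weak
  operator topology.\<close>

definition operator_measure ::
  "'x set \<Rightarrow> ('x \<Rightarrow> complex) set \<Rightarrow>
   ('b::topological_space set \<Rightarrow> ('x \<Rightarrow> complex) \<Rightarrow> ('x \<Rightarrow> complex)) \<Rightarrow> bool" where
  "operator_measure V E \<mu> \<longleftrightarrow>
     (\<forall>\<Delta>\<in>sets borel.
        (\<forall>f\<in>E. \<mu> \<Delta> f \<in> E) \<and>
        (\<forall>f\<in>E. \<forall>g\<in>E. \<forall>c. \<mu> \<Delta> (\<lambda>x. c * f x + g x) = (\<lambda>x. c * \<mu> \<Delta> f x + \<mu> \<Delta> g x)) \<and>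
        (\<exists>C. \<forall>f\<in>E. ell2_norm V (\<mu> \<Delta> f) \<le> C * ell2_norm V f) \<and>
        (\<forall>f\<in>E. ell2_inner V (\<mu> \<Delta> f) f \<in> \<real>\<^sub>\<ge>\<^sub>0)) \<and>
     (\<forall>A. range A \<subseteq> sets borel \<and> disjoint_family A \<longrightarrow>
        (\<forall>f\<in>E. \<forall>g\<in>E.
          (\<lambda>n::nat. ell2_inner V (\<mu> (A n) f) g) sums ell2_inner V (\<mu> (\<Union>n. A n) f) g))"

definition quadratic_measure ::
  "'x set \<Rightarrow> ('b::topological_space set \<Rightarrow> ('x \<Rightarrow> complex) \<Rightarrow> ('x \<Rightarrow> complex)) \<Rightarrow>
   ('x \<Rightarrow> complex) \<Rightarrow> 'b measure" where
  "quadratic_measure V \<mu> f =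
     measure_of UNIV (sets borel) (\<lambda>\<Delta>. ennreal (Re (ell2_inner V (\<mu> \<Delta> f) f)))"

text \<open>Here \<open>\<mu>\<close> is the operator-valued measure \<open>\<rho>\<^sub>\<T> \<times> \<nu>\<^sub>\<T>\<close>. Since \<open>\<Phi>\<^sub>F\<close> and hence \<open>\<Omega>\<^sub>F\<close> are disjoint
  for distinct \<open>F\<close>, the scalar measures are indexed by \<open>u\<close> alone. The supports of the vectors
  \<open>g F u\<close> are pairwise disjoint, so that their sum can be taken pointwise; it is required to be an element of \<open>E\<close>, which is
  automatic when \<open>E\<close> is finite dimensional.\<close>

definition representing_measure ::
  "('n::finite \<Rightarrow> 'v digraph) \<Rightarrow> real \<Rightarrow> ('n set \<Rightarrow> ('n \<Rightarrow> 'v) set) \<Rightarrow> real \<Rightarrow>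
   ((real \<times> (complex ^ 'n)) set \<Rightarrow> (('n \<Rightarrow> 'v) \<Rightarrow> complex) \<Rightarrow> (('n \<Rightarrow> 'v) \<Rightarrow> complex)) \<Rightarrow>
   (('n \<Rightarrow> 'v) \<Rightarrow> real measure) \<Rightarrow> (('n \<Rightarrow> 'v) \<Rightarrow> (complex ^ 'n) measure) \<Rightarrow> bool" where
  "representing_measure T a \<Omega> b \<mu> \<rho> \<nu> \<longleftrightarrow>
     0 < b \<and>
     operator_measure (verts (dprod T)) (joint_kernel T a) \<mu> \<and>
     (\<forall>f\<in>joint_kernel T a. \<mu> (- ({0..b} \<times> sphere 0 1)) f = (\<lambda>_. 0)) \<and>
     (\<forall>F. \<forall>u\<in>\<Omega> F.
        finite_measure (\<rho> u) \<and> sets (\<rho> u) = sets borel \<and> emeasure (\<rho> u) (- {0..b}) = 0 \<and>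
        finite_measure (\<nu> u) \<and> sets (\<nu> u) = sets borel \<and> emeasure (\<nu> u) (- sphere 0 1) = 0) \<and>
     (\<forall>f\<in>joint_kernel T a. \<forall>\<alpha>.
        tuple_power Mz \<alpha> (const_series f) \<in> model_space T a \<and>
        ennreal ((model_norm T a (tuple_power Mz \<alpha> (const_series f)))\<^sup>2) =
          (\<integral>\<^sup>+p\<in>{0..b} \<times> sphere 0 1. ennreal (fst p ^ mabs \<alpha> * (cmod (zpow (snd p) \<alpha>))\<^sup>2)
             \<partial>quadratic_measure (verts (dprod T)) \<mu> f)) \<and>
     (\<forall>\<Delta>\<in>sets borel. \<forall>g.
        (\<forall>F. \<forall>u\<in>\<Omega> F. g F u \<in> Lspace T a u F) \<and>
        (\<lambda>x. \<Sum>F\<in>UNIV. \<Sum>\<^sub>\<infinity>u\<in>\<Omega> F. g F u x) \<in> joint_kernel T a \<longrightarrow>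
        \<mu> \<Delta> (\<lambda>x. \<Sum>F\<in>UNIV. \<Sum>\<^sub>\<infinity>u\<in>\<Omega> F. g F u x) =
          (\<lambda>x. \<Sum>F\<in>UNIV. \<Sum>\<^sub>\<infinity>u\<in>\<Omega> F. complex_of_real (measure (\<rho> u \<Otimes>\<^sub>M \<nu> u) \<Delta>) * g F u x)) \<and>
     prob_space (\<rho> (droot T)) \<and> prob_space (\<nu> (droot T))"

text \<open>The density \<open>w\<^sub>l\<close>; for \<open>d \<ge> 1\<close> the exponent \<open>i + l - 1\<close> is not truncated.\<close>

definition w_density :: "nat \<Rightarrow> nat \<Rightarrow> nat \<Rightarrow> real \<Rightarrow> real" where
  "w_density d a l s =
     (\<Prod>i=d..<a. real l + real i) *
     (\<Sum>i=d..<a. s ^ (i + l - 1) / (\<Prod>j\<in>{d..<a} - {i}. real j - real i))"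

end

theory Submission
  imports Defs "HOL-Real_Asymp.Real_Asymp"
begin

text \<open>Although the weights of the multishift depend on the branching of the trees, the norms of its
  powers on the basis vectors depend on the depth only: with \<open>D(\<delta>) = \<delta>! / (\<bar>\<delta>\<bar> + a - 1)!\<close> one has
  \<open>\<parallel>S\<^sup>\<alpha> f\<parallel>\<^sup>2 = \<Sum>\<^sub>v D(d\<^sub>v + \<alpha>) / D(d\<^sub>v) \<bar>f(v)\<bar>\<^sup>2\<close>. The factor \<open>D(\<delta> + \<alpha>) / D(\<delta>)\<close> is the product of a
  moment of \<open>w\<^bsub>\<bar>\<delta>\<bar>\<^esub>\<close>, which is a beta density, and of a moment of \<open>\<bar>z\<^sup>\<delta>\<bar>\<^sup>2 d\<sigma>\<close>, which is obtained
  by evaluating \<open>\<integral> \<bar>z\<^sup>\<alpha>\<bar>\<^sup>2 exp(-\<bar>z\<bar>\<^sup>2)\<close> in polar and in Cartesian coordinates. So the operator measure may act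
  on the value at \<open>v\<close> as multiplication by \<open>\<rho>\<^sub>v \<times> \<nu>\<^sub>v\<close>. It preserves \<open>E\<close>, because the equations
  \<open>S\<^sub>j\<^sup>* f = 0\<close> relate only values of \<open>f\<close> at vertices of the same depth.\<close>

section \<open>Rooted trees and their products\<close>

text \<open>Branching disappears from the norms because the squared weight of each of the n children
  of a vertex in one direction carries the factor 1/n, and there are n of them. What remains is one
  moment problem for each depth \<delta>: find a measure with moments D(\<delta> + \<alpha>) /
  D(\<delta>). Replacing a by d in D splits this quotient in two. The quotient with d is a ratio of
  moments of the unit sphere and yields the spherical factor. The rest is a quotient of factorials
  depending only on |\<delta>| and |\<alpha>|, namely the |\<alpha>|-th moment of the Beta
  distribution with parameters |\<delta>| + d and a - d. This is where a > d enters; for a = d the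
  rest is 1, the moment of the point mass at 1. Since s occurs with exponent |\<alpha>| and not
  2|\<alpha>|, it plays the part of a squared radius. All measures depend on a vertex through its
  depth alone. Depth is constant on every sibling class, so the operator measure acts on each
  \<open>Lspace T a u F\<close> as a scalar.\<close>

lemma tree_parent_unique:
  assumes "rooted_directed_tree G" "(u, w) \<in> edges G" "(u', w) \<in> edges G"
  shows "u = u'"
proof -
  have "w \<in> verts G" and "\<forall>v\<in>verts G. \<exists>\<^sub>\<le>\<^sub>1u. (u, v) \<in> edges G"
    using assms(1,2) by (auto simp: rooted_directed_tree_def)
  then have "\<exists>\<^sub>\<le>\<^sub>1u. (u, w) \<in> edges G" by simp
  then show ?thesis using assms(2,3) by (rule Uniq_D)
qed

lemma tree_root:
  assumes "rooted_directed_tree G"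
  shows "troot G \<in> verts G" and "(u, troot G) \<notin> edges G"
proof -
  have "\<exists>!r. r \<in> verts G \<and> (\<forall>u. (u, r) \<notin> edges G)"
    using assms unfolding rooted_directed_tree_def by blast
  then have "troot G \<in> verts G \<and> (\<forall>u. (u, troot G) \<notin> edges G)"
    unfolding troot_def by (rule theI')
  then show "troot G \<in> verts G" "(u, troot G) \<notin> edges G" by auto
qed

lemma tree_edge_verts:
  assumes "rooted_directed_tree G" "(u, w) \<in> edges G"
  shows "u \<in> verts G" "w \<in> verts G" "w \<noteq> troot G"
proof -
  have "edges G \<subseteq> verts G \<times> verts G"
    using assms(1) by (simp add: rooted_directed_tree_def)
  then show "u \<in> verts G" "w \<in> verts G" using assms(2) by auto
  show "w \<noteq> troot G" using assms(2) tree_root(2)[OF assms(1)] by auto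
qed

lemma par_eqI:
  assumes "rooted_directed_tree G" "(u, w) \<in> edges G"
  shows "par G w = u"
  unfolding par_def using assms tree_parent_unique[OF assms(1)] by (intro the_equality) auto

lemma par_edge:
  assumes "rooted_directed_tree G" "v \<in> verts G" "v \<noteq> troot G"
  shows "(par G v, v) \<in> edges G"
proof -
  have "\<exists>!r. r \<in> verts G \<and> (\<forall>u. (u, r) \<notin> edges G)"
    using assms(1) by (simp add: rooted_directed_tree_def)
  then obtain u where "(u, v) \<in> edges G"
    using assms(2,3) tree_root[OF assms(1)] by metis
  then show ?thesis using par_eqI[OF assms(1)] by metis
qed

text \<open>Connectedness is that of the undirected graph. A backward step of an undirected path
  from the root undoes the last edge of the directed path found so far, because parents are
  unique.\<close>

lemma tree_reachable:
  assumes G: "rooted_directed_tree G" and v: "v \<in> verts G"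
  shows "(troot G, v) \<in> (edges G)\<^sup>*"
proof -
  have "(troot G, v) \<in> (edges G \<union> (edges G)\<inverse>)\<^sup>*"
    using G v tree_root(1)[OF G] by (simp add: rooted_directed_tree_def)
  then show ?thesis
  proof (induction rule: rtrancl_induct)
    case base
    show ?case by simp
  next
    case (step y z)
    show ?case
    proof (cases "(y, z) \<in> edges G")
      case True
      then show ?thesis using step.IH by simp
    next
      case False
      then have zy: "(z, y) \<in> edges G" using step.hyps by blast
      then have "y \<noteq> troot G" using tree_edge_verts(3)[OF G] by blast
      then obtain z' where "(troot G, z') \<in> (edges G)\<^sup>*" "(z', y) \<in> edges G"
        using step.IH by (metis rtranclE)
      then show ?thesis using tree_parent_unique[OF G zy] by blast
    qed
  qed
qed

text \<open>Justifies the \<open>THE\<close> in \<open>depth\<close>: last edges are stripped from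
  both paths, which have the same parent there, and no path of positive length ends at the
  root.\<close>

lemma tree_level_unique:
  assumes G: "rooted_directed_tree G"
  shows "(troot G, v) \<in> edges G ^^ m \<Longrightarrow> (troot G, v) \<in> edges G ^^ n \<Longrightarrow> m = n"
proof (induction m arbitrary: v n)
  case 0
  then show ?case using tree_root(2)[OF G] by (cases n) auto
next
  case (Suc m)
  from Suc.prems(1) obtain y where y: "(troot G, y) \<in> edges G ^^ m" "(y, v) \<in> edges G" by auto
  with Suc.prems(2) tree_root(2)[OF G] obtain k where k: "n = Suc k" by (cases n) auto
  with Suc.prems(2) obtain y' where y': "(troot G, y') \<in> edges G ^^ k" "(y', v) \<in> edges G" by auto
  then have "y' = y" using y tree_parent_unique[OF G] by blast
  then show ?case using Suc.IH y y' k by simp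
qed

lemma depth_eqI:
  assumes "rooted_directed_tree G" "(troot G, v) \<in> edges G ^^ n"
  shows "depth G v = n"
  unfolding depth_def using assms(2) tree_level_unique[OF assms(1) _ assms(2)]
  by (rule the_equality)

lemma depth_child:
  assumes G: "rooted_directed_tree G" and e: "(u, w) \<in> edges G"
  shows "depth G w = Suc (depth G u)"
proof -
  obtain n where n: "(troot G, u) \<in> edges G ^^ n"
    using tree_reachable[OF G] tree_edge_verts(1)[OF G e] rtrancl_imp_relpow by metis
  then have "(troot G, w) \<in> edges G ^^ Suc n" using e by auto
  then show ?thesis using n depth_eqI[OF G] by simp
qed

lemma depth_sib:
  assumes G: "rooted_directed_tree G" and "v \<in> verts G" "v \<noteq> troot G" "w \<in> sib G v"
  shows "depth G w = depth G v"
  using depth_child[OF G par_edge[OF assms(1-3)]] depth_child[OF G, of "par G v" w] assms(4)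
  by (simp add: sib_def Chi_def)

section \<open>Vertices, depths and weights of the product\<close>

locale tree_product =
  fixes T :: "'n::finite \<Rightarrow> 'v digraph" and a :: nat
  assumes tree: "rooted_directed_tree (T j)"
    and leafless: "leafless (T j)"
    and locally_finite: "locally_finite (T j)"
    and a_pos: "0 < a"
begin

abbreviation "V \<equiv> verts (dprod T)"
abbreviation "S \<equiv> multishift T (real a)"
abbreviation "E \<equiv> joint_kernel T (real a)"

abbreviation up :: "'n \<Rightarrow> ('n \<Rightarrow> 'v) \<Rightarrow> 'n \<Rightarrow> 'v" where
  "up j w \<equiv> w(j := par (T j) (w j))"

lemma verts_dprod: "v \<in> V \<longleftrightarrow> (\<forall>j. v j \<in> verts (T j))"
  by (simp add: dprod_def)

lemma up_verts: "w \<in> V \<Longrightarrow> w j \<noteq> troot (T j) \<Longrightarrow> up j w \<in> V"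
  using tree_edge_verts(1)[OF tree par_edge[OF tree]] by (simp add: verts_dprod)

text \<open>Presents the child relation as the graph of the partial function \<open>up j\<close>.
  When sums over parents and children are exchanged, at most one parent is left for each
  child.\<close>

lemma Chi_at_iff:
  assumes "v \<in> V"
  shows "w \<in> Chi_at T j v \<longleftrightarrow> w \<in> V \<and> w j \<noteq> troot (T j) \<and> v = up j w"
proof
  assume "w \<in> Chi_at T j v"
  then have w: "w \<in> V" "\<And>i. i \<noteq> j \<Longrightarrow> w i = v i" "(v j, w j) \<in> edges (T j)"
    by (auto simp: Chi_at_def Chi_def)
  have "v = up j w"
    using w(2) par_eqI[OF tree w(3)] by (intro ext) simp
  then show "w \<in> V \<and> w j \<noteq> troot (T j) \<and> v = up j w"
    using w(1) tree_edge_verts(3)[OF tree w(3)] by simp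
next
  assume w: "w \<in> V \<and> w j \<noteq> troot (T j) \<and> v = up j w"
  then have "(par (T j) (w j), w j) \<in> edges (T j)"
    by (intro par_edge tree) (simp_all add: verts_dprod)
  then show "w \<in> Chi_at T j v"
    using w by (simp add: Chi_at_def Chi_def)
qed

lemma Chi_at_eq_image:
  assumes "v \<in> V"
  shows "Chi_at T j v = (\<lambda>y. v(j := y)) ` Chi (T j) (v j)"
proof
  show "Chi_at T j v \<subseteq> (\<lambda>y. v(j := y)) ` Chi (T j) (v j)"
  proof
    fix w
    assume "w \<in> Chi_at T j v"
    then have "w = v(j := w j)" "w j \<in> Chi (T j) (v j)"
      by (auto simp: Chi_at_def)
    then show "w \<in> (\<lambda>y. v(j := y)) ` Chi (T j) (v j)" by (rule image_eqI)
  qed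
  show "(\<lambda>y. v(j := y)) ` Chi (T j) (v j) \<subseteq> Chi_at T j v"
    using assms tree_edge_verts(2)[OF tree, of "v j" _ j]
    by (auto simp: Chi_at_def verts_dprod Chi_def)
qed

lemma card_Chi_at: "v \<in> V \<Longrightarrow> card (Chi_at T j v) = card (Chi (T j) (v j))"
  by (subst Chi_at_eq_image) (auto intro!: card_image inj_onI dest: fun_upd_eqD)

lemma finite_Chi_at [simp]: "v \<in> V \<Longrightarrow> finite (Chi_at T j v)"
  using locally_finite[of j] by (simp add: Chi_at_eq_image locally_finite_def verts_dprod)

lemma Chi_at_nonempty: "v \<in> V \<Longrightarrow> Chi_at T j v \<noteq> {}"
  using leafless[of j] by (simp add: Chi_at_eq_image leafless_def verts_dprod)

lemma mdepth_Chi_at: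
  assumes "v \<in> V" "w \<in> Chi_at T j v"
  shows "mdepth T w = (mdepth T v)(j := Suc (mdepth T v j))"
  using assms depth_child[OF tree, of "v j" "w j"]
  by (auto simp: Chi_at_def Chi_def mdepth_def)

text \<open>The reason why a multiplier depending on the depth is a scalar on functions supported in
  \<open>sibF T F u\<close>.\<close>

lemma mdepth_sibF:
  assumes "u \<in> Phi T F" "w \<in> sibF T F u"
  shows "mdepth T w = mdepth T u"
proof
  fix j
  show "mdepth T w j = mdepth T u j"
    using assms depth_sib[OF tree, of "u j" j "w j"]
    by (cases "j \<in> F") (auto simp: Phi_def sibF_def mdepth_def verts_dprod)
qed

lemma multishift_apply:
  "S j f x = (if x \<in> V \<and> x j \<noteq> troot (T j)
     then complex_of_real (da_weight T (real a) j x) * f (up j x) else 0)"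
proof -
  let ?g = "\<lambda>v. f v * (\<Sum>w\<in>Chi_at T j v. complex_of_real (da_weight T a j w) * indicator {w} x)"
  have g: "?g v = (if x \<in> Chi_at T j v then f v * complex_of_real (da_weight T a j x) else 0)"
    if "v \<in> V" for v
  proof -
    have "(\<Sum>w\<in>Chi_at T j v. complex_of_real (da_weight T a j w) * indicator {w} x)
        = (\<Sum>w\<in>Chi_at T j v. if w = x then complex_of_real (da_weight T a j w) else 0)"
      by (intro sum.cong) (auto simp: indicator_def)
    then show ?thesis using that by (simp add: sum.delta')
  qed
  then have S: "S j f x = (\<Sum>\<^sub>\<infinity>v\<in>V. if x \<in> V \<and> x j \<noteq> troot (T j) \<and> v = up j x
      then f v * complex_of_real (da_weight T a j x) else 0)"
    unfolding multishift_def by (intro infsum_cong) (simp add: Chi_at_iff)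
  show ?thesis
  proof (cases "x \<in> V \<and> x j \<noteq> troot (T j)")
    case True
    then have up: "up j x \<in> V" by (simp add: up_verts)
    have "S j f x = (\<Sum>\<^sub>\<infinity>v\<in>{up j x}. complex_of_real (da_weight T a j x) * f v)"
      unfolding S using True up by (intro infsum_cong_neutral) auto
    then show ?thesis using True by simp
  next
    case False
    then show ?thesis unfolding S by (auto intro!: infsum_0)
  qed
qed

lemma da_weight_sq:
  assumes "v \<in> V" "w \<in> Chi_at T j v"
  shows "(da_weight T (real a) j w)\<^sup>2 = 
     (real (mdepth T v j) + 1) / (real (mabs (mdepth T v)) + real a) / real (card (Chi_at T j v))"
proof -
  have "up j w = v" using assms by (simp add: Chi_at_iff)
  then show ?thesis
    unfolding da_weight_def by (simp add: power_mult_distrib power_divide)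
qed

lemma da_weight_nonneg: "0 \<le> da_weight T (real a) j w"
  by (simp add: da_weight_def Let_def)

end

section \<open>Square-summable functions\<close>

text \<open>Tonelli for counting measures, which can fail to be sigma-finite. Indicators extend both
  integrals to \<open>UNIV\<close>, where each iterated integral equals the integral over all
  pairs.\<close>

lemma nn_integral_count_space_swap:
  "(\<integral>\<^sup>+x. \<integral>\<^sup>+y. f x y \<partial>count_space B \<partial>count_space A) =
   (\<integral>\<^sup>+y. \<integral>\<^sup>+x. f x y \<partial>count_space A \<partial>count_space B)"
proof -
  let ?g = "\<lambda>(x, y). f x y * indicator B y * indicator A x"
  have "(\<integral>\<^sup>+x. \<integral>\<^sup>+y. f x y \<partial>count_space B \<partial>count_space A) =
      (\<integral>\<^sup>+x. (\<integral>\<^sup>+y. f x y * indicator B y \<partial>count_space UNIV) * indicator A x \<partial>count_space UNIV)"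
    by (subst nn_integral_count_space_indicator[of A], simp)
       (subst nn_integral_count_space_indicator[of B], simp_all)
  also have "\<dots> = (\<integral>\<^sup>+x. \<integral>\<^sup>+y. ?g (x, y) \<partial>count_space UNIV \<partial>count_space UNIV)"
    by (simp add: nn_integral_multc)
  also have "\<dots> = (\<integral>\<^sup>+y. \<integral>\<^sup>+x. ?g (x, y) \<partial>count_space UNIV \<partial>count_space UNIV)"
    by (subst nn_integral_fst_count_space, subst nn_integral_snd_count_space) simp
  also have "\<dots> = (\<integral>\<^sup>+y. (\<integral>\<^sup>+x. f x y * indicator A x \<partial>count_space UNIV) * indicator B y \<partial>count_space UNIV)"
    by (subst nn_integral_multc[symmetric]) (simp_all add: ac_simps)
  also have "\<dots> = (\<integral>\<^sup>+y. \<integral>\<^sup>+x. f x y \<partial>count_space A \<partial>count_space B)"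
    by (subst nn_integral_count_space_indicator[of B], simp)
       (subst nn_integral_count_space_indicator[of A], simp_all)
  finally show ?thesis .
qed

text \<open>Extended nonnegative integrals always exist, so in this form sums can be exchanged and
  estimated before finiteness is known.\<close>

lemma summable_on_iff_nn_integral:
  fixes g :: "'x \<Rightarrow> real"
  assumes "\<And>x. x \<in> A \<Longrightarrow> 0 \<le> g x"
  shows "g summable_on A \<longleftrightarrow> (\<integral>\<^sup>+x. ennreal (g x) \<partial>count_space A) < \<infinity>"
proof -
  have "g summable_on A \<longleftrightarrow> integrable (count_space A) g"
    by (metis summable_on_iff_abs_summable_on_real abs_summable_equivalent abs_summable_on_def)
  also have "\<dots> \<longleftrightarrow> (\<integral>\<^sup>+x. ennreal (norm (g x)) \<partial>count_space A) < \<infinity>"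
    by (simp add: integrable_iff_bounded)
  also have "(\<integral>\<^sup>+x. ennreal (norm (g x)) \<partial>count_space A) = (\<integral>\<^sup>+x. ennreal (g x) \<partial>count_space A)"
    using assms by (intro nn_integral_cong) simp
  finally show ?thesis .
qed

lemma nn_integral_eq_infsum:
  fixes g :: "'x \<Rightarrow> real"
  assumes "g summable_on A" "\<And>x. x \<in> A \<Longrightarrow> 0 \<le> g x"
  shows "(\<integral>\<^sup>+x. ennreal (g x) \<partial>count_space A) = ennreal (infsum g A)"
proof -
  have "Infinite_Set_Sum.abs_summable_on g A"
    using assms(1) by (metis summable_on_iff_abs_summable_on_real abs_summable_equivalent)
  then show ?thesis
    using nn_integral_conv_infsetsum[of g A] infsetsum_infsum[of g A] assms(2) by simp
qed

lemma ell2_iff: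
  "f \<in> ell2 X \<longleftrightarrow> (\<forall>x. x \<notin> X \<longrightarrow> f x = 0) \<and> (\<integral>\<^sup>+x. ennreal ((cmod (f x))\<^sup>2) \<partial>count_space X) < \<infinity>"
  by (simp add: ell2_def summable_on_iff_nn_integral)

lemma ell2_norm_sq:
  assumes "f \<in> ell2 X"
  shows "ennreal ((ell2_norm X f)\<^sup>2) = (\<integral>\<^sup>+x. ennreal ((cmod (f x))\<^sup>2) \<partial>count_space X)"
  using assms
  by (simp add: ell2_norm_def ell2_def nn_integral_eq_infsum infsum_nonneg)

lemma ell2_mono:
  assumes f: "f \<in> ell2 X" and g: "\<And>x. cmod (g x) \<le> cmod (f x)"
  shows "g \<in> ell2 X"
proof -
  have "(\<integral>\<^sup>+x. ennreal ((cmod (g x))\<^sup>2) \<partial>count_space X) \<le>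
      (\<integral>\<^sup>+x. ennreal ((cmod (f x))\<^sup>2) \<partial>count_space X)"
    by (intro nn_integral_mono ennreal_leI power_mono g) simp
  moreover have "g x = 0" if "x \<notin> X" for x
    using f g[of x] that by (simp add: ell2_iff)
  ultimately show ?thesis using f by (auto simp: ell2_iff intro: le_less_trans)
qed

lemma ell2_norm_mono:
  assumes f: "f \<in> ell2 X" and g: "\<And>x. cmod (g x) \<le> cmod (f x)"
  shows "ell2_norm X g \<le> ell2_norm X f"
  using f ell2_mono[OF assms] unfolding ell2_norm_def
  by (intro real_sqrt_le_mono infsum_mono) (auto simp: ell2_def intro!: power_mono g)

lemma ell2_mult_abs_summable:
  assumes "f \<in> ell2 X" "g \<in> ell2 X"
  shows "(\<lambda>x. norm (f x * cnj (g x))) summable_on X"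
proof (rule Infinite_Sum.abs_summable_on_comparison_test')
  show "(\<lambda>x. (cmod (f x))\<^sup>2 + (cmod (g x))\<^sup>2) summable_on X"
    using assms by (intro summable_on_add) (auto simp: ell2_def)
  show "norm (f x * cnj (g x)) \<le> (cmod (f x))\<^sup>2 + (cmod (g x))\<^sup>2" for x
  proof -
    have "0 \<le> (cmod (f x) - cmod (g x))\<^sup>2 + (cmod (f x))\<^sup>2 + (cmod (g x))\<^sup>2" by simp
    then show ?thesis by (simp add: norm_mult power2_eq_square algebra_simps)
  qed
qed

lemma ell2_zero: "(\<lambda>_. 0) \<in> ell2 X"
  by (simp add: ell2_iff)

lemma ell2_indicator: "v \<in> X \<Longrightarrow> indicator {v} \<in> ell2 X"
  by (subst ell2_iff, subst nn_integral_count_space'[of "{v}"]) (auto simp: indicator_def)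

lemma ell2_inner_indicator: "v \<in> X \<Longrightarrow> ell2_inner X (indicator {v}) h = cnj (h v)"
proof -
  assume "v \<in> X"
  then have "ell2_inner X (indicator {v}) h = (\<Sum>\<^sub>\<infinity>x\<in>{v}. cnj (h x))"
    unfolding ell2_inner_def by (intro infsum_cong_neutral) auto
  then show ?thesis by simp
qed

text \<open>Uniqueness for the \<open>THE\<close>: testing with the indicator of v reads off the
  value at v, and members of \<open>ell2 X\<close> vanish outside X.\<close>

lemma ell2_adjoint_eqI:
  assumes h: "h \<in> ell2 X" and eq: "\<And>f. f \<in> ell2 X \<Longrightarrow> ell2_inner X (A f) g = ell2_inner X f h"
  shows "ell2_adjoint X A g = h"
  unfolding ell2_adjoint_def
proof (rule the_equality)
  show "h \<in> ell2 X \<and> (\<forall>f\<in>ell2 X. ell2_inner X (A f) g = ell2_inner X f h)"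
    using assms by simp
next
  fix h'
  assume h': "h' \<in> ell2 X \<and> (\<forall>f\<in>ell2 X. ell2_inner X (A f) g = ell2_inner X f h')"
  show "h' = h"
  proof
    fix v
    show "h' v = h v"
    proof (cases "v \<in> X")
      case True
      have "cnj (h' v) = cnj (h v)"
        using h' eq[of "indicator {v}"] ell2_indicator[OF True] ell2_inner_indicator[OF True] by metis
      then show ?thesis by simp
    qed (use h h' in \<open>simp add: ell2_def\<close>)
  qed
qed

text \<open>Powers of commuting maps commute, so the fold obeys its recursion in any order and facts
  about it can be proved one coordinate at a time. Everything below that unfolds a
  \<open>tuple_power\<close> goes through this rule.\<close>

lemma tuple_power_induct:
  assumes comm: "\<And>i j f. A i (A j f) = A j (A i f)"
    and empty: "P {} id"
    and insert: "\<And>j F B. finite F \<Longrightarrow> j \<notin> F \<Longrightarrow> P F B \<Longrightarrow> P (insert j F) ((A j ^^ \<alpha> j) \<circ> B)"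
  shows "P UNIV (tuple_power A \<alpha>)"
proof -
  have "comp_fun_commute A" by standard (auto simp: comm)
  then interpret pw: comp_fun_commute "\<lambda>j. A j ^^ \<alpha> j"
    by (rule comp_fun_commute.comp_fun_commute_funpow)
  interpret comp_fun_commute "\<lambda>j B. (A j ^^ \<alpha> j) \<circ> B"
    by standard (use pw.comp_fun_commute in \<open>auto simp: fun_eq_iff\<close>)
  have "P F (Finite_Set.fold (\<lambda>j B. (A j ^^ \<alpha> j) \<circ> B) id F)" if "finite F" for F
    using that
  proof induction
    case empty
    show ?case unfolding Finite_Set.fold_empty by (rule assms(2))
  next
    case (insert j F)
    show ?case unfolding fold_insert[OF insert.hyps] by (intro assms(3) insert)
  qed
  then show ?thesis by (simp add: tuple_power_def)
qed

section \<open>The multishift and the joint kernel\<close>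

text \<open>Up to the constant (a - 1)!, the squared norm of the monomial with exponent \<delta> in
  the space on the unit ball with kernel (1 - <z,w>)^(-a). For positive \<open>a\<close> the
  subtraction does not truncate.\<close>

definition depth_weight :: "nat \<Rightarrow> ('n::finite \<Rightarrow> nat) \<Rightarrow> real" where
  "depth_weight a \<delta> = (\<Prod>j\<in>UNIV. fact (\<delta> j)) / fact (mabs \<delta> + a - 1)"

lemma depth_weight_pos: "0 < depth_weight a \<delta>"
  by (simp add: depth_weight_def prod_pos)

lemma mabs_upd: "mabs (\<delta>(j := k)) + \<delta> j = mabs \<delta> + k"
  by (simp add: mabs_def sum.remove[of UNIV j])

lemma mabs_add: "mabs (\<lambda>j. \<alpha> j + \<beta> j) = mabs \<alpha> + mabs \<beta>"
  by (simp add: mabs_def sum.distrib)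

text \<open>The quotient of consecutive values is the sum of the squared weights over the j-children
  of a vertex of depth \<delta>; \<open>depth_weight\<close> is designed to satisfy this
  recursion.\<close>

lemma depth_weight_Suc:
  assumes "0 < a"
  shows "depth_weight a (\<delta>(j := Suc (\<delta> j))) =
    depth_weight a \<delta> * ((real (\<delta> j) + 1) / (real (mabs \<delta>) + real a))"
proof -
  have m: "mabs (\<delta>(j := Suc (\<delta> j))) = Suc (mabs \<delta>)"
    using mabs_upd[of \<delta> j "Suc (\<delta> j)"] by simp
  have p: "(\<Prod>i\<in>UNIV. fact ((\<delta>(j := Suc (\<delta> j))) i)) = (real (\<delta> j) + 1) * (\<Prod>i\<in>UNIV. fact (\<delta> i))"
    by (simp add: prod.remove[of UNIV j] algebra_simps)
  obtain b where "a = Suc b" using assms by (cases a) auto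
  then show ?thesis
    unfolding depth_weight_def p by (simp add: m field_simps del: fun_upd_apply)
qed

context tree_product
begin

section \<open>Commutation of the shifts and norms of their powers\<close>

lemma mabs_mdepth_up:
  assumes "x \<in> V" "x i \<noteq> troot (T i)"
  shows "mdepth T x = (mdepth T (up i x))(i := Suc (mdepth T (up i x) i))"
    and "mabs (mdepth T x) = Suc (mabs (mdepth T (up i x)))"
proof -
  show *: "mdepth T x = (mdepth T (up i x))(i := Suc (mdepth T (up i x) i))"
    using assms up_verts by (intro mdepth_Chi_at) (simp_all add: Chi_at_iff)
  show "mabs (mdepth T x) = Suc (mabs (mdepth T (up i x)))"
    using mabs_upd[of "mdepth T (up i x)" i "Suc (mdepth T (up i x) i)"] by (subst *) simp
qed

text \<open>Expresses the weight by the vertex itself instead of its parent and separates the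
  branching of coordinate i, the depth in coordinate i and the total depth. The 1 is subtracted
  among the reals to avoid truncation.\<close>

lemma da_weight_up:
  assumes "x \<in> V" "x i \<noteq> troot (T i)"
  shows "da_weight T (real a) i x = 1 / sqrt (real (card (Chi (T i) (par (T i) (x i))))) *
     (sqrt (real (mdepth T x i)) / sqrt (real (mabs (mdepth T x)) - 1 + real a))"
proof -
  have "real (mdepth T x i) = real (mdepth T (up i x) i) + 1"
    using fun_cong[OF mabs_mdepth_up(1)[OF assms], of i] by simp
  moreover have "real (mabs (mdepth T x)) - 1 = real (mabs (mdepth T (up i x)))"
    using mabs_mdepth_up(2)[OF assms] by simp
  ultimately show ?thesis
    unfolding da_weight_def Let_def card_Chi_at[OF up_verts[OF assms]]
    by (simp add: real_sqrt_divide)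
qed

lemma multishift_commute: "S i (S j f) = S j (S i f)"
proof (cases "i = j")
  case False
  show ?thesis
  proof
    fix x
    show "S i (S j f) x = S j (S i f) x"
    proof (cases "x \<in> V \<and> x i \<noteq> troot (T i) \<and> x j \<noteq> troot (T j)")
      case True
      have twist: "up j (up i x) = up i (up j x)"
        using False by (auto simp: fun_eq_iff)
      \<comment> \<open>After a step up in direction k the total depth is smaller by one, hence the
        2 in place of 1, while coordinate l is unchanged. The product of the two weights along
        either route is now symmetric in i and j.\<close>
      have w: "da_weight T (real a) l (up k x) = 
          1 / sqrt (real (card (Chi (T l) (par (T l) (x l))))) *
          (sqrt (real (mdepth T x l)) / sqrt (real (mabs (mdepth T x)) - 2 + real a))"
        if "x k \<noteq> troot (T k)" "x l \<noteq> troot (T l)" "k \<noteq> l" for k l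
      proof -
        have "up k x \<in> V" using True that by (intro up_verts) auto
        moreover have "real (mabs (mdepth T x)) = real (mabs (mdepth T (up k x))) + 1"
          using mabs_mdepth_up(2)[of x k] True that by simp
        ultimately show ?thesis
          using that da_weight_up[of "up k x" l] by (simp add: mdepth_def)
      qed
      have "da_weight T (real a) i x * da_weight T (real a) j (up i x) =
          da_weight T (real a) j x * da_weight T (real a) i (up j x)"
        using True False by (simp add: w da_weight_up ac_simps del: fun_upd_apply)
      then have "complex_of_real (da_weight T (real a) i x) * of_real (da_weight T (real a) j (up i x)) =
          of_real (da_weight T (real a) j x) * of_real (da_weight T (real a) i (up j x))"
        by (metis of_real_mult)
      then show ?thesis
        using True False twist
        by (simp add: multishift_apply up_verts mult.assoc[symmetric])
    next
      case x: False
      then show ?thesis using False by (auto simp: multishift_apply)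
    qed
  qed
qed simp

text \<open>The shift multiplies squared norms by a quotient of values of
  \<open>depth_weight\<close>, which cancels against the denominator; only a translation of \<phi>
  is left. The weight \<phi> is arbitrary so that the step can be iterated with the translated
  one.\<close>

lemma multishift_norm_step:
  fixes \<phi> :: "('n \<Rightarrow> nat) \<Rightarrow> real"
  assumes \<phi>: "\<And>\<delta>. 0 \<le> \<phi> \<delta>"
  shows "(\<integral>\<^sup>+x. ennreal (\<phi> (mdepth T x) / depth_weight a (mdepth T x) * (cmod (S j f x))\<^sup>2) \<partial>count_space V) =
    (\<integral>\<^sup>+v. ennreal (\<phi> ((mdepth T v)(j := Suc (mdepth T v j))) / depth_weight a (mdepth T v) *
        (cmod (f v))\<^sup>2) \<partial>count_space V)"
proof -
  let ?D = "depth_weight a"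
  \<comment> \<open>Pairs of a child x and its parent v. Integrating over v first gives the
    left-hand side, over x first the right-hand side.\<close>
  let ?h = "\<lambda>x v. if x \<in> Chi_at T j v
    then ennreal (\<phi> (mdepth T x) / ?D (mdepth T x) * ((da_weight T (real a) j x)\<^sup>2 * (cmod (f v))\<^sup>2)) else 0"
  have x: "ennreal (\<phi> (mdepth T x) / ?D (mdepth T x) * (cmod (S j f x))\<^sup>2) = (\<integral>\<^sup>+v. ?h x v \<partial>count_space V)"
    if "x \<in> V" for x
  proof (cases "x j = troot (T j)")
    case True
    then have "(\<integral>\<^sup>+v. ?h x v \<partial>count_space V) = (\<integral>\<^sup>+v. 0 \<partial>count_space V)"
      by (intro nn_integral_cong) (simp add: Chi_at_iff)
    then show ?thesis using True by (simp add: multishift_apply)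
  next
    case False
    then have up: "up j x \<in> V" using that by (simp add: up_verts)
    have "(\<integral>\<^sup>+v. ?h x v \<partial>count_space V) = (\<Sum>v\<in>{up j x}. ?h x v)"
      using up by (intro nn_integral_count_space') (auto simp: Chi_at_iff)
    then show ?thesis
      using that False up da_weight_nonneg[of j x]
      by (simp add: Chi_at_iff multishift_apply norm_mult power_mult_distrib)
  qed
  have v: "(\<integral>\<^sup>+x. ?h x v \<partial>count_space V) =
      ennreal (\<phi> ((mdepth T v)(j := Suc (mdepth T v j))) / ?D (mdepth T v) * (cmod (f v))\<^sup>2)"
    if "v \<in> V" for v
  proof -
    let ?\<delta> = "(mdepth T v)(j := Suc (mdepth T v j))"
    let ?q = "(real (mdepth T v j) + 1) / (real (mabs (mdepth T v)) + real a)"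
    let ?n = "real (card (Chi_at T j v))"
    have n: "?n > 0" using that Chi_at_nonempty finite_Chi_at by (simp add: card_gt_0_iff)
    have q: "?q > 0" using a_pos by (simp add: add_nonneg_pos)
    have "(\<integral>\<^sup>+x. ?h x v \<partial>count_space V) = (\<Sum>x\<in>Chi_at T j v. ?h x v)"
      using that by (intro nn_integral_count_space') (auto simp: Chi_at_iff)
    also have "\<dots> = (\<Sum>x\<in>Chi_at T j v. ennreal (\<phi> ?\<delta> / ?D ?\<delta> * (?q / ?n * (cmod (f v))\<^sup>2)))"
      using that by (intro sum.cong) (simp_all add: mdepth_Chi_at da_weight_sq)
    also have "\<dots> = ennreal (?n * (\<phi> ?\<delta> / ?D ?\<delta> * (?q / ?n * (cmod (f v))\<^sup>2)))"
      by (simp only: sum_constant ennreal_of_nat_eq_real_of_nat ennreal_mult' of_nat_0_le_iff)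
    \<comment> \<open>All \<open>?n\<close> children contribute the same amount and each carries the
      factor \<open>1 / ?n\<close>, so the branching number cancels here.\<close>
    also have "?n * (\<phi> ?\<delta> / ?D ?\<delta> * (?q / ?n * (cmod (f v))\<^sup>2)) =
        \<phi> ?\<delta> / ?D (mdepth T v) * (cmod (f v))\<^sup>2"
    proof -
      have "?D ?\<delta> = ?D (mdepth T v) * ?q"
        using depth_weight_Suc[OF a_pos] by simp
      then have "\<phi> ?\<delta> / ?D ?\<delta> * ?q = \<phi> ?\<delta> / ?D (mdepth T v)"
        using q a_pos depth_weight_pos[of a "mdepth T v"] by (auto simp del: fun_upd_apply)
      moreover have "?n * (\<phi> ?\<delta> / ?D ?\<delta> * (?q / ?n * (cmod (f v))\<^sup>2)) =
          (\<phi> ?\<delta> / ?D ?\<delta> * ?q) * (cmod (f v))\<^sup>2"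
        using n by (simp del: fun_upd_apply)
      ultimately show ?thesis by metis
    qed
    finally show ?thesis .
  qed
  have "(\<integral>\<^sup>+x. ennreal (\<phi> (mdepth T x) / ?D (mdepth T x) * (cmod (S j f x))\<^sup>2) \<partial>count_space V) =
      (\<integral>\<^sup>+x. \<integral>\<^sup>+v. ?h x v \<partial>count_space V \<partial>count_space V)"
    by (intro nn_integral_cong x) simp
  also have "\<dots> = (\<integral>\<^sup>+v. \<integral>\<^sup>+x. ?h x v \<partial>count_space V \<partial>count_space V)"
    by (rule nn_integral_count_space_swap)
  also have "\<dots> = (\<integral>\<^sup>+v. ennreal (\<phi> ((mdepth T v)(j := Suc (mdepth T v j))) / ?D (mdepth T v) *
        (cmod (f v))\<^sup>2) \<partial>count_space V)"
    by (intro nn_integral_cong v) simp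
  finally show ?thesis .
qed

lemma multishift_funpow_norm:
  fixes \<phi> :: "('n \<Rightarrow> nat) \<Rightarrow> real"
  assumes "\<And>\<delta>. 0 \<le> \<phi> \<delta>"
  shows "(\<integral>\<^sup>+x. ennreal (\<phi> (mdepth T x) / depth_weight a (mdepth T x) * (cmod ((S j ^^ n) f x))\<^sup>2) \<partial>count_space V) =
    (\<integral>\<^sup>+v. ennreal (\<phi> ((mdepth T v)(j := mdepth T v j + n)) / depth_weight a (mdepth T v) *
        (cmod (f v))\<^sup>2) \<partial>count_space V)"
  using assms
proof (induction n arbitrary: \<phi>)
  case (Suc n)
  have e: "(\<delta>(j := \<delta> j + n))(j := Suc ((\<delta>(j := \<delta> j + n)) j)) = \<delta>(j := \<delta> j + Suc n)" for \<delta> :: "'n \<Rightarrow> nat"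
    by simp
  show ?case
    using multishift_norm_step[of \<phi> j "(S j ^^ n) f"] Suc.IH[of "\<lambda>\<delta>. \<phi> (\<delta>(j := Suc (\<delta> j)))"] Suc.prems
    unfolding e by (simp del: fun_upd_apply)
qed simp

lemma tuple_power_multishift_norm:
  "(\<integral>\<^sup>+x. ennreal ((cmod (tuple_power S \<alpha> f x))\<^sup>2) \<partial>count_space V) =
   (\<integral>\<^sup>+v. ennreal (depth_weight a (\<lambda>j. mdepth T v j + \<alpha> j) / depth_weight a (mdepth T v) *
        (cmod (f v))\<^sup>2) \<partial>count_space V)"
proof -
  \<comment> \<open>The property ranges over all \<phi>, since adding the coordinate j uses the
    hypothesis for \<phi> translated in direction j.\<close>
  let ?P = "\<lambda>F B. \<forall>\<phi> f. (\<forall>\<delta>. 0 \<le> \<phi> \<delta>) \<longrightarrow>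
    (\<integral>\<^sup>+x. ennreal (\<phi> (mdepth T x) / depth_weight a (mdepth T x) * (cmod (B f x))\<^sup>2) \<partial>count_space V) =
    (\<integral>\<^sup>+v. ennreal (\<phi> (\<lambda>j. mdepth T v j + (if j \<in> F then \<alpha> j else 0)) / depth_weight a (mdepth T v) *
        (cmod (f v))\<^sup>2) \<partial>count_space V)"
  have "?P UNIV (tuple_power S \<alpha>)"
  proof (rule tuple_power_induct[where P = ?P])
    show "S i (S j f) = S j (S i f)" for i j f
      by (rule multishift_commute)
  next
    show "?P {} id" by simp
  next
    fix j F B
    assume j: "j \<notin> F" and P: "?P F B"
    have e: "(\<lambda>i. \<delta> i + (if i \<in> F then \<alpha> i else 0))(j := \<delta> j + \<alpha> j) =
        (\<lambda>i. \<delta> i + (if i \<in> insert j F then \<alpha> i else 0))" for \<delta>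
      using j by (auto simp: fun_eq_iff)
    show "?P (insert j F) ((S j ^^ \<alpha> j) \<circ> B)"
    proof (intro allI impI)
      fix \<phi> :: "('n \<Rightarrow> nat) \<Rightarrow> real" and f :: "('n \<Rightarrow> 'v) \<Rightarrow> complex"
      assume \<phi>: "\<forall>\<delta>. 0 \<le> \<phi> \<delta>"
      then show "(\<integral>\<^sup>+x. ennreal (\<phi> (mdepth T x) / depth_weight a (mdepth T x) *
            (cmod (((S j ^^ \<alpha> j) \<circ> B) f x))\<^sup>2) \<partial>count_space V) =
          (\<integral>\<^sup>+v. ennreal (\<phi> (\<lambda>i. mdepth T v i + (if i \<in> insert j F then \<alpha> i else 0)) /
            depth_weight a (mdepth T v) * (cmod (f v))\<^sup>2) \<partial>count_space V)"
        using multishift_funpow_norm[of \<phi> "\<alpha> j" j "B f"]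
          P[rule_format, of "\<lambda>\<delta>. \<phi> (\<delta>(j := \<delta> j + \<alpha> j))" f] j
        by (simp add: e del: fun_upd_apply)
    qed
  qed
  \<comment> \<open>With \<phi> equal to \<open>depth_weight a\<close> the weight on the left-hand
    side is 1, leaving the plain norm.\<close>
  from this[rule_format, of "depth_weight a" f, OF less_imp_le[OF depth_weight_pos]] show ?thesis
    by (simp add: less_imp_neq[OF depth_weight_pos, symmetric])
qed

text \<open>One coordinate of the depth is at most the total depth, and a is at least 1. In effect
  every shift is a contraction.\<close>

lemma sum_da_weight_sq_le:
  assumes "v \<in> V"
  shows "(\<Sum>w\<in>Chi_at T j v. (da_weight T (real a) j w)\<^sup>2) \<le> 1"
proof -
  have "mdepth T v j \<le> mabs (mdepth T v)"
    unfolding mabs_def by (rule member_le_sum) auto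
  then have "(real (mdepth T v j) + 1) / (real (mabs (mdepth T v)) + real a) \<le> 1"
    using a_pos by simp
  moreover have "card (Chi_at T j v) \<noteq> 0"
    using assms Chi_at_nonempty finite_Chi_at by simp
  ultimately show ?thesis
    using assms by (simp add: da_weight_sq)
qed

lemma multishift_ell2:
  assumes "f \<in> ell2 V"
  shows "S j f \<in> ell2 V"
proof -
  let ?D = "depth_weight a"
  have "(\<integral>\<^sup>+x. ennreal ((cmod (S j f x))\<^sup>2) \<partial>count_space V) =
      (\<integral>\<^sup>+v. ennreal (?D ((mdepth T v)(j := Suc (mdepth T v j))) / ?D (mdepth T v) * (cmod (f v))\<^sup>2) \<partial>count_space V)"
    using multishift_norm_step[of ?D j f, OF less_imp_le[OF depth_weight_pos]]
    by (simp add: less_imp_neq[OF depth_weight_pos, symmetric])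
  also have "\<dots> \<le> (\<integral>\<^sup>+v. ennreal ((cmod (f v))\<^sup>2) \<partial>count_space V)"
  proof (intro nn_integral_mono ennreal_leI)
    fix v
    have "mdepth T v j \<le> mabs (mdepth T v)"
      unfolding mabs_def by (rule member_le_sum) auto
    then have "(real (mdepth T v j) + 1) / (real (mabs (mdepth T v)) + real a) \<le> 1"
      using a_pos by simp
    then have "?D ((mdepth T v)(j := Suc (mdepth T v j))) / ?D (mdepth T v) \<le> 1"
      using depth_weight_pos[of a "mdepth T v"] unfolding depth_weight_Suc[OF a_pos] by simp
    then show "?D ((mdepth T v)(j := Suc (mdepth T v j))) / ?D (mdepth T v) * (cmod (f v))\<^sup>2 \<le> (cmod (f v))\<^sup>2"
      by (intro mult_left_le_one_le divide_nonneg_nonneg less_imp_le[OF depth_weight_pos]) auto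
  qed
  also have "\<dots> < \<infinity>" using assms by (simp add: ell2_iff)
  finally show ?thesis by (simp add: ell2_iff multishift_apply)
qed

lemma tuple_power_multishift_ell2:
  assumes "f \<in> ell2 V"
  shows "tuple_power S \<alpha> f \<in> ell2 V"
proof -
  have pow: "(S j ^^ n) f \<in> ell2 V" if "f \<in> ell2 V" for j n f
    using that by (induction n) (simp_all add: multishift_ell2)
  have "\<forall>f\<in>ell2 V. tuple_power S \<alpha> f \<in> ell2 V"
    by (rule tuple_power_induct[where P = "\<lambda>F B. \<forall>f\<in>ell2 V. B f \<in> ell2 V"])
       (simp_all add: multishift_commute pow)
  then show ?thesis using assms by simp
qed

section \<open>The adjoints of the shifts and the joint kernel\<close>

definition backshift :: "'n \<Rightarrow> (('n \<Rightarrow> 'v) \<Rightarrow> complex) \<Rightarrow> ('n \<Rightarrow> 'v) \<Rightarrow> complex" where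
  "backshift j g = (\<lambda>v. if v \<in> V
     then \<Sum>w\<in>Chi_at T j v. complex_of_real (da_weight T (real a) j w) * g w else 0)"

text \<open>By Cauchy-Schwarz the value at v is controlled by the children of v, because their
  squared weights sum to at most 1. Every w is a j-child of at most one v, so summing over v counts
  no value of g twice.\<close>

lemma backshift_ell2:
  assumes g: "g \<in> ell2 V"
  shows "backshift j g \<in> ell2 V"
proof -
  let ?h = "\<lambda>v w. if w \<in> Chi_at T j v then ennreal ((cmod (g w))\<^sup>2) else 0"
  have "ennreal ((cmod (backshift j g v))\<^sup>2) \<le> (\<integral>\<^sup>+w. ?h v w \<partial>count_space V)" if v: "v \<in> V" for v
  proof -
    have "cmod (backshift j g v) \<le> (\<Sum>w\<in>Chi_at T j v. da_weight T (real a) j w * cmod (g w))"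
      using v da_weight_nonneg
      by (auto simp: backshift_def norm_mult intro!: order_trans[OF norm_sum])
    then have "(cmod (backshift j g v))\<^sup>2 \<le> (\<Sum>w\<in>Chi_at T j v. da_weight T (real a) j w * cmod (g w))\<^sup>2"
      by (intro power_mono) auto
    also have "\<dots> \<le> (\<Sum>w\<in>Chi_at T j v. (da_weight T (real a) j w)\<^sup>2) * (\<Sum>w\<in>Chi_at T j v. (cmod (g w))\<^sup>2)"
      by (rule Cauchy_Schwarz_ineq_sum)
    also have "\<dots> \<le> (\<Sum>w\<in>Chi_at T j v. (cmod (g w))\<^sup>2)"
      using sum_da_weight_sq_le[OF v] by (intro mult_left_le_one_le) (auto intro!: sum_nonneg)
    finally have "ennreal ((cmod (backshift j g v))\<^sup>2) \<le> (\<Sum>w\<in>Chi_at T j v. ennreal ((cmod (g w))\<^sup>2))"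
      by (simp add: ennreal_leI sum_ennreal)
    also have "\<dots> = (\<Sum>w\<in>Chi_at T j v. ?h v w)" by simp
    also have "\<dots> = (\<integral>\<^sup>+w. ?h v w \<partial>count_space V)"
      using v by (intro nn_integral_count_space'[symmetric]) (auto simp: Chi_at_iff)
    finally show ?thesis .
  qed
  then have "(\<integral>\<^sup>+v. ennreal ((cmod (backshift j g v))\<^sup>2) \<partial>count_space V) \<le>
      (\<integral>\<^sup>+v. \<integral>\<^sup>+w. ?h v w \<partial>count_space V \<partial>count_space V)"
    by (intro nn_integral_mono) simp
  also have "\<dots> = (\<integral>\<^sup>+w. \<integral>\<^sup>+v. ?h v w \<partial>count_space V \<partial>count_space V)"
    by (rule nn_integral_count_space_swap)
  also have "\<dots> \<le> (\<integral>\<^sup>+w. ennreal ((cmod (g w))\<^sup>2) \<partial>count_space V)"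
  proof (intro nn_integral_mono)
    fix w
    assume "w \<in> space (count_space V)"
    show "(\<integral>\<^sup>+v. ?h v w \<partial>count_space V) \<le> ennreal ((cmod (g w))\<^sup>2)"
    proof (cases "up j w \<in> V")
      case True
      then have "(\<integral>\<^sup>+v. ?h v w \<partial>count_space V) = (\<Sum>v\<in>{up j w}. ?h v w)"
        by (intro nn_integral_count_space') (auto simp: Chi_at_iff)
      then show ?thesis by simp
    next
      case False
      then have "(\<integral>\<^sup>+v. ?h v w \<partial>count_space V) = (\<integral>\<^sup>+v. 0 \<partial>count_space V)"
        by (intro nn_integral_cong) (auto simp: Chi_at_iff)
      then show ?thesis by simp
    qed
  qed
  also have "\<dots> < \<infinity>" using g by (simp add: ell2_iff)
  finally show ?thesis by (simp add: ell2_iff backshift_def)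
qed

text \<open>Vertices with a non-root coordinate j correspond to pairs of a parent and a j-child of
  it. Reindexing by these pairs and grouping them by parent moves the shift to the other factor. The
  product of two members of \<open>ell2\<close> is absolutely summable, which permits the
  regrouping.\<close>

lemma ell2_inner_multishift:
  assumes f: "f \<in> ell2 V" and g: "g \<in> ell2 V"
  shows "ell2_inner V (S j f) g = ell2_inner V f (backshift j g)"
proof -
  let ?V = "{x \<in> V. x j \<noteq> troot (T j)}"
  let ?A = "Sigma V (Chi_at T j)"
  let ?F = "\<lambda>v w. complex_of_real (da_weight T (real a) j w) * f v * cnj (g w)"
  have bij: "bij_betw snd ?A ?V"
    by (rule bij_betw_byWitness[where f' = "\<lambda>w. (up j w, w)"])
       (auto simp: Chi_at_iff up_verts)
  have eq: "S j f w * cnj (g w) = ?F v w" if "v \<in> V" "w \<in> Chi_at T j v" for v w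
    using that by (simp add: Chi_at_iff multishift_apply)
  have "(\<lambda>x. S j f x * cnj (g x)) summable_on V"
    using ell2_mult_abs_summable[OF multishift_ell2[OF f] g] by (rule abs_summable_summable)
  then have "(\<lambda>x. S j f x * cnj (g x)) summable_on ?V"
    by (rule summable_on_subset_banach) auto
  then have "(\<lambda>p. S j f (snd p) * cnj (g (snd p))) summable_on ?A"
    by (subst summable_on_reindex_bij_betw[OF bij])
  also have "?this \<longleftrightarrow> (\<lambda>(v, w). ?F v w) summable_on ?A"
    by (rule summable_on_cong) (auto simp: eq)
  finally have sm: "(\<lambda>(v, w). ?F v w) summable_on ?A" .
  have "ell2_inner V (S j f) g = (\<Sum>\<^sub>\<infinity>x\<in>?V. S j f x * cnj (g x))"
    unfolding ell2_inner_def by (intro infsum_cong_neutral) (auto simp: multishift_apply)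
  also have "\<dots> = (\<Sum>\<^sub>\<infinity>p\<in>?A. S j f (snd p) * cnj (g (snd p)))"
    by (rule infsum_reindex_bij_betw[OF bij, symmetric])
  also have "\<dots> = (\<Sum>\<^sub>\<infinity>(v, w)\<in>?A. ?F v w)"
    by (intro infsum_cong) (auto simp: eq)
  also have "\<dots> = (\<Sum>\<^sub>\<infinity>v\<in>V. \<Sum>\<^sub>\<infinity>w\<in>Chi_at T j v. ?F v w)"
    by (rule infsum_Sigma'_banach[OF sm, symmetric])
  also have "\<dots> = ell2_inner V f (backshift j g)"
    unfolding ell2_inner_def
    by (intro infsum_cong) (simp add: backshift_def sum_distrib_left mult_ac)
  finally show ?thesis .
qed

lemma ell2_adjoint_multishift: "g \<in> ell2 V \<Longrightarrow> ell2_adjoint V (S j) g = backshift j g"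
  by (intro ell2_adjoint_eqI backshift_ell2 ell2_inner_multishift)

lemma joint_kernel_iff: "f \<in> E \<longleftrightarrow> f \<in> ell2 V \<and> (\<forall>j. backshift j f = (\<lambda>_. 0))"
  by (auto simp: joint_kernel_def ell2_adjoint_multishift)

lemma joint_kernel_zero: "(\<lambda>_. 0) \<in> E"
  by (auto simp: joint_kernel_iff ell2_zero backshift_def fun_eq_iff)

lemma joint_kernel_depth_mult:
  assumes f: "f \<in> E" and m: "\<And>\<delta>. \<bar>m \<delta>\<bar> \<le> 1"
  shows "(\<lambda>v. complex_of_real (m (mdepth T v)) * f v) \<in> E"
proof -
  have "(\<lambda>v. complex_of_real (m (mdepth T v)) * f v) \<in> ell2 V"
  proof (rule ell2_mono)
    show "f \<in> ell2 V" using f by (simp add: joint_kernel_iff)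
    show "cmod (complex_of_real (m (mdepth T v)) * f v) \<le> cmod (f v)" for v
      using mult_right_mono[OF m norm_ge_zero, of "mdepth T v" "f v"] by (simp add: norm_mult)
  qed
  moreover have "backshift j (\<lambda>v. complex_of_real (m (mdepth T v)) * f v) = (\<lambda>_. 0)" for j
  proof
    fix v
    show "backshift j (\<lambda>v. complex_of_real (m (mdepth T v)) * f v) v = 0"
    proof (cases "v \<in> V")
      case True
      \<comment> \<open>The common depth of all j-children of v, which lets the multiplier leave the
        sum.\<close>
      let ?\<delta> = "(mdepth T v)(j := Suc (mdepth T v j))"
      have "backshift j (\<lambda>v. complex_of_real (m (mdepth T v)) * f v) v =
          (\<Sum>w\<in>Chi_at T j v. complex_of_real (m ?\<delta>) * (complex_of_real (da_weight T (real a) j w) * f w))"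
        unfolding backshift_def if_P[OF True]
        by (intro sum.cong refl, subst mdepth_Chi_at[OF True], assumption) (simp only: mult.left_commute)
      also have "\<dots> = complex_of_real (m ?\<delta>) * backshift j f v"
        using True by (simp add: backshift_def sum_distrib_left)
      also have "\<dots> = 0" using f by (simp add: joint_kernel_iff)
      finally show ?thesis .
    qed (simp add: backshift_def)
  qed
  ultimately show ?thesis by (simp add: joint_kernel_iff)
qed

section \<open>Monomials in the analytic model\<close>

lemma Mz_funpow: "(Mz j ^^ n) f = (\<lambda>\<alpha>. if \<alpha> j < n then (\<lambda>_. 0) else f (\<alpha>(j := \<alpha> j - n)))"
proof (induction n)
  case (Suc n)
  show ?case
  proof
    fix \<alpha>
    show "(Mz j ^^ Suc n) f \<alpha> = (if \<alpha> j < Suc n then (\<lambda>_. 0) else f (\<alpha>(j := \<alpha> j - Suc n)))"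
      unfolding funpow.simps comp_apply Suc.IH by (auto simp: Mz_def)
  qed
qed simp

lemma Mz_commute: "Mz i (Mz j f) = Mz j (Mz i f)"
proof (cases "i = j")
  case False
  show ?thesis
  proof
    fix \<alpha>
    show "Mz i (Mz j f) \<alpha> = Mz j (Mz i f) \<alpha>"
      using False fun_upd_twist[OF False, of \<alpha>] by (simp add: Mz_def)
  qed
qed simp

lemma tuple_power_Mz_const:
  fixes f :: "('n \<Rightarrow> 'v) \<Rightarrow> complex" and \<alpha> :: "'n \<Rightarrow> nat"
  shows "tuple_power Mz \<alpha> (const_series f) = (\<lambda>\<beta>. if \<beta> = \<alpha> then f else (\<lambda>_. 0))"
proof -
  have "tuple_power Mz \<alpha> (const_series f) = (\<lambda>\<beta>. if \<beta> = (\<lambda>j. if j \<in> UNIV then \<alpha> j else 0) then f else (\<lambda>_. 0))"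
  proof (rule tuple_power_induct[where
      P = "\<lambda>F B. B (const_series f) = (\<lambda>\<beta>. if \<beta> = (\<lambda>j. if j \<in> F then \<alpha> j else 0) then f else (\<lambda>_. 0))"])
    show "Mz i (Mz j f) = Mz j (Mz i f)" for i j and f :: "('n, 'v) vseries"
      by (rule Mz_commute)
  next
    show "id (const_series f) = (\<lambda>\<beta>. if \<beta> = (\<lambda>j. if j \<in> {} then \<alpha> j else 0) then f else (\<lambda>_. 0))"
      by (simp add: const_series_def)
  next
    fix j F and B :: "('n, 'v) vseries \<Rightarrow> ('n, 'v) vseries"
    assume j: "j \<notin> F"
      and B: "B (const_series f) = (\<lambda>\<beta>. if \<beta> = (\<lambda>j. if j \<in> F then \<alpha> j else 0) then f else (\<lambda>_. 0))"
    \<comment> \<open>Truncated subtraction sends every \<beta> j up to \<alpha> j to 0, so the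
      update alone does not determine \<beta> j. The first conjunct restores equality with \<alpha>
      j.\<close>
    have eq: "\<not> \<beta> j < \<alpha> j \<and> \<beta>(j := \<beta> j - \<alpha> j) = (\<lambda>j. if j \<in> F then \<alpha> j else 0) \<longleftrightarrow>
        \<beta> = (\<lambda>i. if i \<in> insert j F then \<alpha> i else 0)" (is "?L \<longleftrightarrow> ?R") for \<beta>
    proof
      assume L: ?L
      show ?R
      proof
        fix i
        show "\<beta> i = (if i \<in> insert j F then \<alpha> i else 0)"
          using conjunct1[OF L] fun_cong[OF conjunct2[OF L], of i] j
          by (cases "i = j") auto
      qed
    next
      assume R: ?R
      show ?L unfolding R using j by auto
    qed
    show "((Mz j ^^ \<alpha> j) \<circ> B) (const_series f) =
        (\<lambda>\<beta>. if \<beta> = (\<lambda>i. if i \<in> insert j F then \<alpha> i else 0) then f else (\<lambda>_. 0))"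
      unfolding eq[symmetric] comp_apply B Mz_funpow by (intro ext) simp
  qed
  then show ?thesis by simp
qed

lemma tuple_power_multishift_zero: "tuple_power S \<alpha> (\<lambda>_. 0) = (\<lambda>_. 0)"
proof -
  have z: "(S j ^^ n) (\<lambda>_. 0) = (\<lambda>_. 0)" for j n
    by (induction n) (auto simp: multishift_apply fun_eq_iff)
  show ?thesis
    by (rule tuple_power_induct[where P = "\<lambda>F B. B (\<lambda>_. 0) = (\<lambda>_. 0)"])
       (simp_all add: multishift_commute z)
qed

text \<open>The series has the single coefficient f at \<alpha>, so the sum defining the model norm
  has one term, the squared norm of the power of the multishift applied to f.\<close>

lemma model_monomial:
  assumes f: "f \<in> E"
  shows "tuple_power Mz \<alpha> (const_series f) \<in> model_space T (real a)"
    and "ennreal ((model_norm T (real a) (tuple_power Mz \<alpha> (const_series f)))\<^sup>2) =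
      (\<integral>\<^sup>+v. ennreal (depth_weight a (\<lambda>j. mdepth T v j + \<alpha> j) / depth_weight a (mdepth T v) *
        (cmod (f v))\<^sup>2) \<partial>count_space V)"
proof -
  let ?t = "\<lambda>\<beta>. (ell2_norm V (tuple_power S \<beta> (tuple_power Mz \<alpha> (const_series f) \<beta>)))\<^sup>2"
  have t: "?t \<beta> = 0" if "\<beta> \<noteq> \<alpha>" for \<beta>
    using that by (simp add: tuple_power_Mz_const tuple_power_multishift_zero ell2_norm_def)
  have "?t summable_on {\<alpha>} \<longleftrightarrow> ?t summable_on UNIV"
    by (rule summable_on_cong_neutral) (auto simp: t)
  then have "?t summable_on UNIV" by simp
  then show "tuple_power Mz \<alpha> (const_series f) \<in> model_space T (real a)"
    using f by (auto simp: model_space_def tuple_power_Mz_const joint_kernel_zero)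
  have "(\<Sum>\<^sub>\<infinity>\<beta>. ?t \<beta>) = (\<Sum>\<^sub>\<infinity>\<beta>\<in>{\<alpha>}. ?t \<beta>)"
    by (rule infsum_cong_neutral) (auto simp: t)
  then have "(model_norm T (real a) (tuple_power Mz \<alpha> (const_series f)))\<^sup>2 = (ell2_norm V (tuple_power S \<alpha> f))\<^sup>2"
    by (simp add: model_norm_def tuple_power_Mz_const)
  then show "ennreal ((model_norm T (real a) (tuple_power Mz \<alpha> (const_series f)))\<^sup>2) =
      (\<integral>\<^sup>+v. ennreal (depth_weight a (\<lambda>j. mdepth T v j + \<alpha> j) / depth_weight a (mdepth T v) *
        (cmod (f v))\<^sup>2) \<partial>count_space V)"
    using f ell2_norm_sq[OF tuple_power_multishift_ell2] tuple_power_multishift_norm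
    by (simp add: joint_kernel_iff)
qed

end

section \<open>Polar coordinates and moments of the sphere\<close>

lemma indicator_ball_measurable [measurable]:
  "(indicator (ball x r) :: 'a::euclidean_space \<Rightarrow> ennreal) \<in> borel_measurable borel"
  by (rule borel_measurable_indicator) simp

lemma nn_integral_scale_ball:
  fixes h :: "'a::euclidean_space \<Rightarrow> ennreal"
  assumes h [measurable]: "h \<in> borel_measurable borel"
    and hom: "\<And>t x. 0 < t \<Longrightarrow> h (t *\<^sub>R x) = ennreal (t ^ p) * h x"
    and t: "0 < t"
  shows "(\<integral>\<^sup>+x. h x * indicator (ball 0 t) x \<partial>lborel) =
    ennreal (t ^ (p + DIM('a))) * (\<integral>\<^sup>+x. h x * indicator (ball 0 1) x \<partial>lborel)"
proof -
  have "(\<integral>\<^sup>+x. h x * indicator (ball 0 t) x \<partial>lborel) =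
      (\<integral>\<^sup>+x. h x * indicator (ball 0 t) x
        \<partial>density (distr lborel borel (\<lambda>x. 0 + t *\<^sub>R x)) (\<lambda>_. ennreal (\<bar>t\<bar> ^ DIM('a))))"
    using t lborel_affine[of t "0::'a"] by simp
  also have "\<dots> = ennreal (t ^ DIM('a)) * (\<integral>\<^sup>+x. h (t *\<^sub>R x) * indicator (ball 0 t) (t *\<^sub>R x) \<partial>lborel)"
    using t by (subst nn_integral_density, simp, simp, subst nn_integral_distr)
      (simp_all add: nn_integral_cmult)
  also have "(\<integral>\<^sup>+x. h (t *\<^sub>R x) * indicator (ball 0 t) (t *\<^sub>R x) \<partial>lborel) =
      (\<integral>\<^sup>+x. ennreal (t ^ p) * (h x * indicator (ball 0 1) x) \<partial>lborel)"
    using t by (intro nn_integral_cong) (auto simp: hom indicator_def)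
  also have "\<dots> = ennreal (t ^ p) * (\<integral>\<^sup>+x. h x * indicator (ball 0 1) x \<partial>lborel)"
    by (rule nn_integral_cmult) measurable
  finally show ?thesis
    using t by (simp add: power_add ennreal_mult'' mult_ac)
qed

text \<open>A substitute for integration in polar coordinates. The radial factor is written as an
  integral over s > \<open>norm x\<close>; after exchanging the integrals the inner one runs over
  the ball of radius s, where homogeneity reduces it to the unit ball.\<close>

lemma nn_integral_layer_cake:
  fixes h :: "'a::euclidean_space \<Rightarrow> ennreal" and \<psi> :: "real \<Rightarrow> ennreal"
  assumes h [measurable]: "h \<in> borel_measurable borel" and \<psi> [measurable]: "\<psi> \<in> borel_measurable borel"
    and hom: "\<And>t x. 0 < t \<Longrightarrow> h (t *\<^sub>R x) = ennreal (t ^ p) * h x"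
  shows "(\<integral>\<^sup>+x. h x * (\<integral>\<^sup>+s. \<psi> s * indicator {norm x<..} s \<partial>lborel) \<partial>lborel) =
    (\<integral>\<^sup>+s. \<psi> s * ennreal (s ^ (p + DIM('a))) * indicator {0<..} s \<partial>lborel) *
    (\<integral>\<^sup>+x. h x * indicator (ball 0 1) x \<partial>lborel)"
proof -
  let ?I = "\<integral>\<^sup>+x. h x * indicator (ball 0 1) x \<partial>lborel"
  have "(\<integral>\<^sup>+x. h x * (\<integral>\<^sup>+s. \<psi> s * indicator {norm x<..} s \<partial>lborel) \<partial>lborel) =
      (\<integral>\<^sup>+x. \<integral>\<^sup>+s. h x * (\<psi> s * (if norm x < s then 1 else 0)) \<partial>lborel \<partial>lborel)"
    by (simp add: nn_integral_cmult indicator_def of_bool_def)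
  also have "\<dots> = (\<integral>\<^sup>+s. \<integral>\<^sup>+x. h x * (\<psi> s * (if norm x < s then 1 else 0)) \<partial>lborel \<partial>lborel)"
    by (rule lborel_pair.Fubini') measurable
  also have "\<dots> = (\<integral>\<^sup>+s. (\<psi> s * ennreal (s ^ (p + DIM('a))) * indicator {0<..} s) * ?I \<partial>lborel)"
  proof (intro nn_integral_cong)
    fix s :: real
    have "(\<integral>\<^sup>+x. h x * (\<psi> s * (if norm x < s then 1 else 0)) \<partial>lborel) =
        (\<integral>\<^sup>+x. \<psi> s * (h x * indicator (ball 0 s) x) \<partial>lborel)"
      by (intro nn_integral_cong) (auto simp: indicator_def mult_ac)
    also have "\<dots> = \<psi> s * (\<integral>\<^sup>+x. h x * indicator (ball 0 s) x \<partial>lborel)"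
      by (rule nn_integral_cmult) measurable
    also have "\<dots> = (\<psi> s * ennreal (s ^ (p + DIM('a))) * indicator {0<..} s) * ?I"
    proof (cases "0 < s")
      case True
      then show ?thesis by (subst nn_integral_scale_ball[OF h hom]) (simp_all add: mult_ac)
    next
      case False
      then have e: "ball (0::'a) s = {}" by (simp add: ball_eq_empty)
      show ?thesis unfolding e using False by simp
    qed
    finally show "(\<integral>\<^sup>+x. h x * (\<psi> s * (if norm x < s then 1 else 0)) \<partial>lborel) =
      (\<psi> s * ennreal (s ^ (p + DIM('a))) * indicator {0<..} s) * ?I" .
  qed
  also have "\<dots> = (\<integral>\<^sup>+s. \<psi> s * ennreal (s ^ (p + DIM('a))) * indicator {0<..} s \<partial>lborel) * ?I"
    by (simp add: nn_integral_multc)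
  finally show ?thesis .
qed

lemma nn_integral_greaterThan_eq_atLeast:
  fixes f :: "real \<Rightarrow> ennreal"
  assumes [measurable]: "f \<in> borel_measurable borel"
  shows "(\<integral>\<^sup>+s. f s * indicator {r<..} s \<partial>lborel) = (\<integral>\<^sup>+s. f s * indicator {r..} s \<partial>lborel)"
  by (rule nn_integral_cong_AE, rule AE_mp[OF AE_lborel_singleton[of r]]) (auto simp: indicator_def)

text \<open>Brings the Gaussian into the tail form that the layer cake formula requires.\<close>

lemma gaussian_tail:
  assumes "0 \<le> r"
  shows "(\<integral>\<^sup>+s. ennreal (2 * s * exp (- s\<^sup>2)) * indicator {r<..} s \<partial>lborel) = ennreal (exp (- r\<^sup>2))"
proof -
  have "(\<integral>\<^sup>+s. ennreal (2 * s * exp (- s\<^sup>2)) * indicator {r..} s \<partial>lborel) = ennreal (0 - (- exp (- r\<^sup>2)))"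
  proof (rule nn_integral_FTC_atLeast)
    show "((\<lambda>s::real. - exp (- s\<^sup>2)) \<longlongrightarrow> 0) at_top" by real_asymp
  qed (use assms in \<open>auto intro!: derivative_eq_intros\<close>)
  then show ?thesis by (simp add: nn_integral_greaterThan_eq_atLeast)
qed

lemma gaussian_moment:
  "(\<integral>\<^sup>+s. ennreal (2 * s * exp (- s\<^sup>2)) * ennreal (s ^ (2 * k)) * indicator {0<..} s \<partial>lborel) = ennreal (fact k)"
proof -
  let ?g = "\<lambda>s::real. indicator {0..} s *\<^sub>R (exp (- s\<^sup>2) * s ^ (2 * k + 1))"
  have "(\<integral>\<^sup>+s. ennreal (?g s) \<partial>lborel) = ennreal (fact k / 2)"
    using gaussian_moment_odd_pos[of k]
    by (subst nn_integral_eq_integral)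
       (auto simp: has_bochner_integral_iff indicator_def)
  moreover have "(\<integral>\<^sup>+s. ennreal (2 * s * exp (- s\<^sup>2)) * ennreal (s ^ (2 * k)) * indicator {0<..} s \<partial>lborel) =
      (\<integral>\<^sup>+s. 2 * ennreal (?g s) \<partial>lborel)"
    by (intro nn_integral_cong)
       (auto simp: indicator_def ennreal_mult''[symmetric] ennreal_numeral[symmetric] mult_ac simp del: ennreal_numeral)
  ultimately show ?thesis
    by (simp add: nn_integral_cmult ennreal_mult''[symmetric] ennreal_numeral[symmetric] del: ennreal_numeral)
qed

text \<open>The second radial function used in tail form. It serves to compare the integral of a
  homogeneous function over the ball with that of its radially constant version.\<close>

lemma power_tail:
  assumes "0 \<le> r" "r \<le> 1" "0 < p"
  shows "(\<integral>\<^sup>+s. ennreal (real p * s ^ (p - 1)) * indicator {0..1} s * indicator {r<..} s \<partial>lborel) = ennreal (1 - r ^ p)"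
proof -
  have "(\<integral>\<^sup>+s. ennreal (real p * s ^ (p - 1)) * indicator {0..1} s * indicator {r<..} s \<partial>lborel) =
      (\<integral>\<^sup>+s. ennreal (real p * s ^ (p - 1)) * indicator {0..1} s * indicator {r..} s \<partial>lborel)"
    by (rule nn_integral_greaterThan_eq_atLeast) measurable
  also have "\<dots> = (\<integral>\<^sup>+s. ennreal (real p * s ^ (p - 1)) * indicator {r..1} s \<partial>lborel)"
    using assms by (intro nn_integral_cong) (auto simp: indicator_def)
  also have "\<dots> = ennreal (1 ^ p - r ^ p)"
    using assms by (intro nn_integral_FTC_Icc) (auto intro!: derivative_eq_intros)
  finally show ?thesis by simp
qed

lemma power_moment:
  assumes "0 < p"
  shows "(\<integral>\<^sup>+s. ennreal (real p * s ^ (p - 1)) * indicator {0..1} s * ennreal (s ^ n) * indicator {0<..} s \<partial>lborel) =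
    ennreal (real p / real (p + n))"
proof -
  have "(\<integral>\<^sup>+s. ennreal (real p * s ^ (p - 1)) * indicator {0..1} s * ennreal (s ^ n) * indicator {0<..} s \<partial>lborel) =
      (\<integral>\<^sup>+s. ennreal (real p / real (p + n)) * (ennreal (real (p + n) * s ^ (p + n - 1)) * indicator {0..1} s * indicator {0<..} s) \<partial>lborel)"
  proof (intro nn_integral_cong)
    fix s :: real
    have "real p * s ^ (p - 1) * s ^ n = real p / real (p + n) * (real (p + n) * s ^ (p + n - 1))"
      using assms by (simp add: power_add[symmetric])
    then have "0 \<le> s \<Longrightarrow> ennreal (real p * s ^ (p - 1)) * ennreal (s ^ n) =
        ennreal (real p / real (p + n)) * ennreal (real (p + n) * s ^ (p + n - 1))"
      by (simp add: ennreal_mult[symmetric] del: of_nat_add)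
    then show "ennreal (real p * s ^ (p - 1)) * indicator {0..1} s * ennreal (s ^ n) * indicator {0<..} s =
        ennreal (real p / real (p + n)) * (ennreal (real (p + n) * s ^ (p + n - 1)) * indicator {0..1} s * indicator {0<..} s)"
      by (auto simp: indicator_def)
  qed
  also have "\<dots> = ennreal (real p / real (p + n))"
    using assms power_tail[of 0 "p + n"] by (subst nn_integral_cmult) (simp_all add: zero_power)
  finally show ?thesis .
qed

lemma sgn_measurable [measurable]: "(sgn :: 'a::euclidean_space \<Rightarrow> 'a) \<in> borel_measurable borel"
  unfolding sgn_div_norm by measurable

text \<open>The layer cake formula is applied twice. The Gaussian tail gives (k + d)! times the
  integral I of h over the unit ball, and the tail of a power shows that I is d / (k + d) times the
  integral J of the radially constant function h o sgn.\<close>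

lemma nn_integral_gaussian_polar:
  fixes h :: "'a::euclidean_space \<Rightarrow> ennreal"
  assumes h [measurable]: "h \<in> borel_measurable borel"
    and hom: "\<And>t x. 0 < t \<Longrightarrow> h (t *\<^sub>R x) = ennreal (t ^ (2 * k)) * h x"
    and dim: "DIM('a) = 2 * d"
    and fin: "(\<integral>\<^sup>+x. h (sgn x) * indicator (ball 0 1) x \<partial>lborel) < \<infinity>"
  shows "(\<integral>\<^sup>+x. h x * ennreal (exp (- (norm x)\<^sup>2)) \<partial>lborel) =
    ennreal (real d * fact (k + d - 1)) * (\<integral>\<^sup>+x. h (sgn x) * indicator (ball 0 1) x \<partial>lborel)"
proof -
  define I where "I = (\<integral>\<^sup>+x. h x * indicator (ball 0 1) x \<partial>lborel)"
  define J where "J = (\<integral>\<^sup>+x. h (sgn x) * indicator (ball 0 1) x \<partial>lborel)"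
  have d: "0 < d" using dim DIM_positive[where 'a='a] by simp
  have hsgn: "h x = ennreal (norm x ^ (2 * k)) * h (sgn x)" if "x \<noteq> 0" for x
    using hom[of "norm x" "sgn x"] that by (simp add: sgn_div_norm)
  have "(\<integral>\<^sup>+x. h x * ennreal (exp (- (norm x)\<^sup>2)) \<partial>lborel) =
      (\<integral>\<^sup>+x. h x * (\<integral>\<^sup>+s. ennreal (2 * s * exp (- s\<^sup>2)) * indicator {norm x<..} s \<partial>lborel) \<partial>lborel)"
    by (simp add: gaussian_tail)
  also have "\<dots> = (\<integral>\<^sup>+s. ennreal (2 * s * exp (- s\<^sup>2)) * ennreal (s ^ (2 * k + DIM('a))) * indicator {0<..} s \<partial>lborel) * I"
    unfolding I_def by (rule nn_integral_layer_cake) (auto simp: hom)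
  also have "\<dots> = ennreal (fact (k + d)) * I"
    unfolding dim distrib_left[symmetric] gaussian_moment by simp
  finally have G: "(\<integral>\<^sup>+x. h x * ennreal (exp (- (norm x)\<^sup>2)) \<partial>lborel) = ennreal (fact (k + d)) * I" .
  \<comment> \<open>Written as a sum because I and J are still extended reals. The case k = 0 is
    separate: there the tail density would vanish, and h agrees with h o sgn off the origin.\<close>
  have IJ: "I + ennreal (real k / real (k + d)) * J = J"
  proof (cases "k = 0")
    case True
    have "I = J"
      unfolding I_def J_def
      by (rule nn_integral_cong_AE, rule AE_mp[OF AE_lborel_singleton[of 0]]) (use hsgn True in auto)
    then show ?thesis using True by simp
  next
    case False
    \<comment> \<open>Its tail is 1 - r^(2k) on the unit ball and 0 outside. Since h(x) is the 2k-th
      power of the norm times h(sgn x), integrating this tail against h o sgn produces what I lacks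
      to J.\<close>
    let ?\<psi> = "\<lambda>s. ennreal (real (2 * k) * s ^ (2 * k - 1)) * indicator {0..1} s"
    have hom0: "h (sgn (t *\<^sub>R x)) = ennreal (t ^ 0) * h (sgn x)" if "0 < t" for t and x :: 'a
      using that by (simp add: sgn_scaleR)
    have "(\<integral>\<^sup>+x. h (sgn x) * (\<integral>\<^sup>+s. ?\<psi> s * indicator {norm x<..} s \<partial>lborel) \<partial>lborel) =
        (\<integral>\<^sup>+s. ?\<psi> s * ennreal (s ^ (0 + DIM('a))) * indicator {0<..} s \<partial>lborel) * J"
      unfolding J_def by (rule nn_integral_layer_cake) (auto simp: hom0)
    also have "\<dots> = ennreal (real k / real (k + d)) * J"
    proof -
      have "real (2 * k) / real (2 * k + 2 * d) = real k / real (k + d)"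
        using d by (simp add: field_simps)
      then show ?thesis
        using power_moment[of "2 * k" "2 * d"] False by (simp add: dim)
    qed
    also have "(\<integral>\<^sup>+x. h (sgn x) * (\<integral>\<^sup>+s. ?\<psi> s * indicator {norm x<..} s \<partial>lborel) \<partial>lborel) =
        (\<integral>\<^sup>+x. h (sgn x) * (ennreal (1 - norm x ^ (2 * k)) * indicator (ball 0 1) x) \<partial>lborel)"
    proof (intro nn_integral_cong arg_cong2[where f = times] refl)
      fix x :: 'a
      show "(\<integral>\<^sup>+s. ?\<psi> s * indicator {norm x<..} s \<partial>lborel) = ennreal (1 - norm x ^ (2 * k)) * indicator (ball 0 1) x"
      proof (cases "norm x < 1")
        case True
        then show ?thesis using power_tail[of "norm x" "2 * k"] False by simp
      next
        case nx: False
        have "(\<integral>\<^sup>+s. ?\<psi> s * indicator {norm x<..} s \<partial>lborel) = (\<integral>\<^sup>+s. 0 \<partial>(lborel :: real measure))"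
          using nx by (intro nn_integral_cong) (auto simp: indicator_def)
        then show ?thesis using nx by simp
      qed
    qed
    finally have "I + ennreal (real k / real (k + d)) * J =
        I + (\<integral>\<^sup>+x. h (sgn x) * (ennreal (1 - norm x ^ (2 * k)) * indicator (ball 0 1) x) \<partial>lborel)"
      by simp
    also have "\<dots> = (\<integral>\<^sup>+x. h x * indicator (ball 0 1) x +
        h (sgn x) * (ennreal (1 - norm x ^ (2 * k)) * indicator (ball 0 1) x) \<partial>lborel)"
      unfolding I_def by (rule nn_integral_add[symmetric]) measurable
    also have "\<dots> = J"
      unfolding J_def
    proof (rule nn_integral_cong_AE, rule AE_mp[OF AE_lborel_singleton[of 0]], intro AE_I2 impI)
      fix x :: 'a
      assume x: "x \<noteq> 0"
      show "h x * indicator (ball 0 1) x + h (sgn x) * (ennreal (1 - norm x ^ (2 * k)) * indicator (ball 0 1) x) =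
          h (sgn x) * indicator (ball 0 1) x"
      proof (cases "norm x < 1")
        case True
        then have "norm x ^ (2 * k) \<le> 1" by (simp add: power_le_one)
        then have "ennreal (norm x ^ (2 * k)) + ennreal (1 - norm x ^ (2 * k)) = 1"
          by (simp add: ennreal_plus[symmetric] del: ennreal_plus)
        then have "(ennreal (norm x ^ (2 * k)) + ennreal (1 - norm x ^ (2 * k))) * h (sgn x) = h (sgn x)" by simp
        then show ?thesis using True x by (simp add: hsgn[OF x] distrib_left mult.commute)
      qed simp
    qed
    finally show ?thesis .
  qed
  \<comment> \<open>Finiteness of J, and hence of I, moves the relation to the reals, where it can
    be solved for I.\<close>
  obtain j where j: "J = ennreal j" "0 \<le> j" using fin unfolding J_def[symmetric] by (cases J) auto
  have "I \<le> J" using IJ by (metis le_iff_add)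
  then obtain i where i: "I = ennreal i" "0 \<le> i" using j by (cases I) (auto simp: top_unique)
  have "i + real k / real (k + d) * j = j"
    using IJ i j by (simp add: ennreal_mult''[symmetric] ennreal_plus[symmetric] del: ennreal_plus)
  then have "real (k + d) * i = real d * j"
    using d by (simp add: field_simps)
  moreover have "(fact (k + d) :: real) = fact (k + d - 1) * real (k + d)"
    using d by (subst fact_reduce) auto
  ultimately have "fact (k + d) * i = real d * fact (k + d - 1) * j" by simp
  then show ?thesis
    unfolding G J_def[symmetric] i j using i j by (simp add: ennreal_mult''[symmetric])
qed

section \<open>Lebesgue measure on a finite power and Gaussian integrals\<close>

lemma measurable_vec_lambda:
  "(\<lambda>f. \<chi> i. f i) \<in> (\<Pi>\<^sub>M i\<in>UNIV. lborel) \<rightarrow>\<^sub>M (borel :: ('a::euclidean_space ^ 'n::finite) measure)"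
  by (subst borel_measurable_euclidean_space) (auto simp: Basis_vec_def inner_axis)

text \<open>Lebesgue measure is determined by the volumes of boxes, and boxes correspond to products
  of boxes in the coordinates. The volumes agree because \<open>Basis\<close> of the power is the
  disjoint union of the images of \<open>Basis\<close> under \<open>axis i\<close>.\<close>

lemma lborel_vec_eq:
  "(lborel :: ('a::euclidean_space ^ 'n::finite) measure) = distr (\<Pi>\<^sub>M i\<in>UNIV. lborel) borel (\<lambda>f. \<chi> i. f i)"
proof (rule lborel_eqI)
  interpret product_sigma_finite "\<lambda>_::'n. lborel :: 'a measure" ..
  fix l u :: "'a ^ 'n"
  assume le: "\<And>b. b \<in> Basis \<Longrightarrow> l \<bullet> b \<le> u \<bullet> b"
  have le': "l $ i \<bullet> b \<le> u $ i \<bullet> b" if "b \<in> Basis" for i b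
    using le[of "axis i b"] that by (auto simp: inner_axis Basis_vec_def)
  have box: "(\<lambda>f. \<chi> i. f i) -` box l u \<inter> space (\<Pi>\<^sub>M i\<in>UNIV. lborel) = (\<Pi>\<^sub>E i\<in>UNIV. box (l $ i) (u $ i))"
    by (auto simp: space_PiM box_def Basis_vec_def inner_axis PiE_def)
  have "emeasure (distr (\<Pi>\<^sub>M i\<in>UNIV. lborel) borel (\<lambda>f. \<chi> i. f i)) (box l u) =
      (\<Prod>i\<in>UNIV. emeasure lborel (box (l $ i) (u $ i)))"
    by (subst emeasure_distr[OF measurable_vec_lambda]) (simp_all add: box emeasure_PiM)
  also have "\<dots> = ennreal (\<Prod>i\<in>UNIV. \<Prod>b\<in>Basis. (u $ i - l $ i) \<bullet> b)"
    using le' by (simp add: emeasure_lborel_box prod_ennreal prod_nonneg inner_diff_left)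
  also have "(\<Prod>i\<in>UNIV. \<Prod>b\<in>Basis. (u $ i - l $ i) \<bullet> b) = (\<Prod>b\<in>Basis. (u - l) \<bullet> b)"
  proof -
    have "(\<Prod>i\<in>UNIV. \<Prod>b\<in>Basis. (u $ i - l $ i) \<bullet> b) =
        (\<Prod>i\<in>UNIV. \<Prod>b\<in>axis i ` Basis. (u - l) \<bullet> b)"
      by (intro prod.cong refl, subst prod.reindex) (auto simp: inj_on_def axis_eq_axis inner_axis)
    also have "\<dots> = (\<Prod>b\<in>(\<Union>i\<in>UNIV. axis i ` Basis). (u - l) \<bullet> b)"
      by (rule prod.UNION_disjoint[symmetric]) (auto simp: axis_eq_axis)
    also have "(\<Union>i\<in>UNIV. axis i ` Basis) = (Basis :: ('a ^ 'n) set)"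
      by (auto simp: Basis_vec_def)
    finally show ?thesis .
  qed
  finally show "emeasure (distr (\<Pi>\<^sub>M i\<in>UNIV. lborel) borel (\<lambda>f. \<chi> i. f i)) (box l u) = (\<Prod>b\<in>Basis. (u - l) \<bullet> b)" .
qed simp

lemma nn_integral_lborel_vec_prod:
  fixes f :: "'n::finite \<Rightarrow> 'a::euclidean_space \<Rightarrow> ennreal"
  assumes f [measurable]: "\<And>i. f i \<in> borel_measurable borel"
  shows "(\<integral>\<^sup>+z. (\<Prod>i\<in>UNIV. f i (z $ i)) \<partial>lborel) = (\<Prod>i\<in>UNIV. \<integral>\<^sup>+x. f i x \<partial>lborel)"
proof -
  interpret product_sigma_finite "\<lambda>_::'n. lborel :: 'a measure" ..
  have nth: "(\<lambda>z. z $ i) \<in> (borel :: ('a ^ 'n) measure) \<rightarrow>\<^sub>M borel" for i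
    by (intro borel_measurable_continuous_onI continuous_intros)
  have "(\<lambda>z. \<Prod>i\<in>UNIV. f i (z $ i)) \<in> borel_measurable (borel :: ('a ^ 'n) measure)"
    by (intro borel_measurable_prod_ennreal measurable_compose[OF nth f])
  then have "(\<integral>\<^sup>+z. (\<Prod>i\<in>UNIV. f i (z $ i)) \<partial>lborel) =
      (\<integral>\<^sup>+x. (\<Prod>i\<in>UNIV. f i (x i)) \<partial>(\<Pi>\<^sub>M i\<in>UNIV. lborel))"
    by (subst lborel_vec_eq, subst nn_integral_distr[OF measurable_vec_lambda]) simp_all
  also have "\<dots> = (\<Prod>i\<in>UNIV. \<integral>\<^sup>+x. f i x \<partial>lborel)"
    by (rule product_nn_integral_prod) auto
  finally show ?thesis .
qed

lemma zpow_continuous: "continuous_on UNIV (\<lambda>z. zpow z \<alpha>)"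
  unfolding zpow_def by (intro continuous_intros)

lemma zpow_measurable [measurable]: "(\<lambda>z. zpow z \<alpha>) \<in> borel_measurable borel"
  using zpow_continuous by (rule borel_measurable_continuous_onI)

lemma zpow_scaleR: "zpow (t *\<^sub>R z) \<alpha> = of_real (t ^ mabs \<alpha>) * zpow z \<alpha>"
  by (simp add: zpow_def mabs_def scaleR_conv_of_real[where 'a=complex] power_mult_distrib prod.distrib power_sum)

lemma zpow_add: "zpow z (\<lambda>j. \<alpha> j + \<beta> j) = zpow z \<alpha> * zpow z \<beta>"
  by (simp add: zpow_def power_add prod.distrib)

lemma cmod_zpow_le_one:
  assumes "norm z \<le> 1"
  shows "cmod (zpow z \<alpha>) \<le> 1"
proof -
  have "cmod (z $ j) \<le> 1" for j
    using Finite_Cartesian_Product.norm_nth_le[of z j] assms by linarith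
  then show ?thesis
    unfolding zpow_def prod_norm[symmetric] norm_power by (intro prod_le_1) (auto intro: power_le_one)
qed

text \<open>The polar formula in real dimension 2, where the radially constant version of a power of
  \<open>cmod\<close> is 1 off the origin and J is the area of the disc.\<close>

lemma nn_integral_gaussian_complex:
  "(\<integral>\<^sup>+z. ennreal ((cmod z) ^ (2 * k)) * ennreal (exp (- (cmod z)\<^sup>2)) \<partial>lborel) =
    ennreal (fact k * unit_ball_vol 2)"
proof -
  let ?h = "\<lambda>z::complex. ennreal ((cmod z) ^ (2 * k))"
  have J: "(\<integral>\<^sup>+z. ?h (sgn z) * indicator (ball 0 1) z \<partial>lborel) = ennreal (unit_ball_vol 2)"
  proof -
    have "(\<integral>\<^sup>+z. ?h (sgn z) * indicator (ball 0 1) z \<partial>lborel) = (\<integral>\<^sup>+z. indicator (ball (0::complex) 1) z \<partial>lborel)"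
      by (rule nn_integral_cong_AE, rule AE_mp[OF AE_lborel_singleton[of 0]]) (auto simp: norm_sgn)
    also have "\<dots> = emeasure lborel (ball (0::complex) 1)" by simp
    finally show ?thesis by (simp only: emeasure_ball) simp
  qed
  have "(\<integral>\<^sup>+z. ?h z * ennreal (exp (- (cmod z)\<^sup>2)) \<partial>lborel) =
      ennreal (real 1 * fact (k + 1 - 1)) * (\<integral>\<^sup>+z. ?h (sgn z) * indicator (ball 0 1) z \<partial>lborel)"
    by (rule nn_integral_gaussian_polar[where k = k])
       (auto simp: J power_mult_distrib ennreal_mult'')
  then show ?thesis by (simp add: J ennreal_mult'')
qed

text \<open>Both the monomial and the Gaussian factor over the coordinates, so the integral is a
  product of integrals over the complex plane.\<close>

lemma nn_integral_gaussian_zpow: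
  "(\<integral>\<^sup>+z. ennreal ((cmod (zpow z \<alpha>))\<^sup>2) * ennreal (exp (- (norm z)\<^sup>2)) \<partial>(lborel :: (complex ^ 'n::finite) measure)) =
    ennreal ((\<Prod>j\<in>UNIV. fact (\<alpha> j)) * unit_ball_vol 2 ^ CARD('n))"
proof -
  let ?f = "\<lambda>j z. ennreal ((cmod z) ^ (2 * \<alpha> j)) * ennreal (exp (- (cmod z)\<^sup>2))"
  have "ennreal ((cmod (zpow z \<alpha>))\<^sup>2) * ennreal (exp (- (norm z)\<^sup>2)) = (\<Prod>j\<in>UNIV. ?f j (z $ j))"
    for z :: "complex ^ 'n"
  proof -
    have "(cmod (zpow z \<alpha>))\<^sup>2 = (\<Prod>j\<in>UNIV. (cmod (z $ j)) ^ (2 * \<alpha> j))"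
      by (simp add: zpow_def prod_norm[symmetric] norm_power prod_power_distrib power_mult[symmetric] mult.commute)
    moreover have "(norm z)\<^sup>2 = (\<Sum>j\<in>UNIV. (cmod (z $ j))\<^sup>2)"
      by (simp add: norm_vec_def L2_set_def sum_nonneg)
    ultimately show ?thesis
      by (simp add: sum_negf[symmetric] exp_sum prod_ennreal prod.distrib[symmetric] ennreal_mult''[symmetric] prod_nonneg)
  qed
  then have "(\<integral>\<^sup>+z. ennreal ((cmod (zpow z \<alpha>))\<^sup>2) * ennreal (exp (- (norm z)\<^sup>2)) \<partial>(lborel :: (complex ^ 'n) measure)) =
      (\<integral>\<^sup>+z. (\<Prod>j\<in>UNIV. ?f j (z $ j)) \<partial>(lborel :: (complex ^ 'n) measure))"
    by simp
  also have "\<dots> = (\<Prod>j\<in>UNIV. ennreal (fact (\<alpha> j) * unit_ball_vol 2))"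
    by (subst nn_integral_lborel_vec_prod) (simp_all add: nn_integral_gaussian_complex)
  also have "\<dots> = ennreal (\<Prod>j\<in>UNIV. fact (\<alpha> j) * unit_ball_vol 2)"
    by (rule prod_ennreal) simp
  finally show ?thesis by (simp add: prod.distrib)
qed

section \<open>Surface measure and its moments\<close>

lemma nn_integral_sphere_measure:
  fixes h :: "complex ^ 'n::finite \<Rightarrow> ennreal"
  assumes [measurable]: "h \<in> borel_measurable borel"
  shows "(\<integral>\<^sup>+z. h z \<partial>sphere_measure) =
    (\<integral>\<^sup>+z. h (sgn z) * indicator (ball 0 1) z \<partial>lborel) / emeasure lborel (ball (0 :: complex ^ 'n) 1)"
  unfolding sphere_measure_def
  by (simp add: nn_integral_distr nn_integral_uniform_measure)

lemma AE_sphere_measure: "AE z in (sphere_measure :: (complex ^ 'n::finite) measure). norm z = 1"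
proof -
  have "AE z in lborel. norm (sgn (z :: complex ^ 'n)) = 1"
    by (rule AE_mp[OF AE_lborel_singleton[of 0]]) (auto simp: norm_sgn)
  then show ?thesis
    unfolding sphere_measure_def
    by (subst AE_distr_iff) (auto intro!: AE_uniform_measureI)
qed

lemma sets_sphere_measure [measurable_cong, simp]: "sets sphere_measure = sets borel"
  by (simp add: sphere_measure_def)

text \<open>This is (d - 1)! times \<open>depth_weight d\<close> for d = \<open>CARD('n)\<close>.
  For a = d, therefore, the norms of the multishift are ratios of spherical moments.\<close>

definition sphere_moment :: "('n::finite \<Rightarrow> nat) \<Rightarrow> real" where
  "sphere_moment \<alpha> = (\<Prod>j\<in>UNIV. fact (\<alpha> j)) * fact (CARD('n) - 1) / fact (mabs \<alpha> + CARD('n) - 1)"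

lemma sphere_moment_pos: "0 < sphere_moment \<alpha>"
  by (simp add: sphere_moment_def prod_pos)

text \<open>The two evaluations of the Gaussian integral are divided by those for exponent 0. There
  \<open>?J\<close> is the volume of the unit ball, so this volume and the power of
  \<open>unit_ball_vol 2\<close> drop out.\<close>

lemma nn_integral_sphere_zpow:
  "(\<integral>\<^sup>+z. ennreal ((cmod (zpow z \<alpha>))\<^sup>2) \<partial>(sphere_measure :: (complex ^ 'n::finite) measure)) =
    ennreal (sphere_moment \<alpha>)"
proof -
  let ?d = "CARD('n)"
  let ?J = "\<lambda>\<alpha>. \<integral>\<^sup>+z. ennreal ((cmod (zpow (sgn z) \<alpha>))\<^sup>2) * indicator (ball 0 1) z \<partial>(lborel :: (complex ^ 'n) measure)"
  let ?v = "emeasure lborel (ball (0 :: complex ^ 'n) 1)"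
  have v: "?v \<noteq> 0" "?v < \<infinity>" by (simp_all add: emeasure_ball less_imp_neq[OF unit_ball_vol_pos, symmetric])
  have J_le: "?J \<alpha> \<le> ?v" for \<alpha>
  proof -
    have "?J \<alpha> \<le> (\<integral>\<^sup>+z. indicator (ball 0 1) z \<partial>(lborel :: (complex ^ 'n) measure))"
    proof (intro nn_integral_mono)
      fix z :: "complex ^ 'n"
      have "(cmod (zpow (sgn z) \<alpha>))\<^sup>2 \<le> 1"
        by (intro power_le_one cmod_zpow_le_one) (auto simp: norm_sgn)
      then have "ennreal ((cmod (zpow (sgn z) \<alpha>))\<^sup>2) \<le> 1" by simp
      then show "ennreal ((cmod (zpow (sgn z) \<alpha>))\<^sup>2) * indicator (ball 0 1) z \<le> indicator (ball 0 1) z"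
        by (auto simp: indicator_def)
    qed
    then show ?thesis by simp
  qed
  have J: "ennreal (real ?d * fact (mabs \<alpha> + ?d - 1)) * ?J \<alpha> =
      ennreal ((\<Prod>j\<in>UNIV. fact (\<alpha> j)) * unit_ball_vol 2 ^ ?d)" for \<alpha>
  proof -
    have "(\<integral>\<^sup>+z. ennreal ((cmod (zpow z \<alpha>))\<^sup>2) * ennreal (exp (- (norm z)\<^sup>2)) \<partial>(lborel :: (complex ^ 'n) measure)) =
        ennreal (real ?d * fact (mabs \<alpha> + ?d - 1)) * ?J \<alpha>"
    proof (rule nn_integral_gaussian_polar[where k = "mabs \<alpha>"])
      show "ennreal ((cmod (zpow (t *\<^sub>R z) \<alpha>))\<^sup>2) = ennreal (t ^ (2 * mabs \<alpha>)) * ennreal ((cmod (zpow z \<alpha>))\<^sup>2)"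
        if "0 < t" for t and z :: "complex ^ 'n"
        using that by (simp add: zpow_scaleR norm_mult power_mult_distrib ennreal_mult'' power_mult[symmetric] mult.commute norm_power)
      show "?J \<alpha> < \<infinity>" using J_le[of \<alpha>] v(2) by (rule le_less_trans)
    qed auto
    then show ?thesis by (simp only: nn_integral_gaussian_zpow)
  qed
  obtain v where v': "?v = ennreal v" "0 < v"
    using v by (cases ?v) (auto simp: less_le)
  have "?J \<alpha> < \<infinity>" using J_le[of \<alpha>] v(2) by (rule le_less_trans)
  then obtain j where j: "?J \<alpha> = ennreal j" "0 \<le> j"
    by (cases "?J \<alpha>") auto
  have J0: "?J (\<lambda>_. 0) = ?v" by (simp add: zpow_def)
  have m0: "mabs (\<lambda>_::'n. 0) = 0" by (simp add: mabs_def)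
  have "real ?d * fact (?d - 1) * v = unit_ball_vol 2 ^ ?d"
    using J[of "\<lambda>_. 0"] v' unfolding J0 m0 by (simp add: ennreal_mult''[symmetric])
  moreover have "real ?d * fact (mabs \<alpha> + ?d - 1) * j = (\<Prod>j\<in>UNIV. fact (\<alpha> j)) * unit_ball_vol 2 ^ ?d"
    using J[of \<alpha>] j by (simp add: ennreal_mult''[symmetric] prod_nonneg)
  ultimately have "real ?d * (fact (mabs \<alpha> + ?d - 1) * j) = real ?d * ((\<Prod>j\<in>UNIV. fact (\<alpha> j)) * fact (?d - 1) * v)"
    by (simp add: mult_ac)
  then have "fact (mabs \<alpha> + ?d - 1) * j = (\<Prod>j\<in>UNIV. fact (\<alpha> j)) * fact (?d - 1) * v"
    by simp
  then have "j / v = sphere_moment \<alpha>"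
    using v' by (simp add: sphere_moment_def field_simps)
  then show ?thesis
    using v' j by (simp add: nn_integral_sphere_measure divide_ennreal)
qed

section \<open>The scalar measures\<close>

text \<open>Indices below i give the sign and (i - d)!, those above i give (a - 1 - i)!. Up to a
  common factorial, the reciprocals are signed binomial coefficients.\<close>

lemma prod_diff_remove:
  assumes "d \<le> i" "i < a"
  shows "(\<Prod>j\<in>{d..<a} - {i}. real j - real i) = (- 1) ^ (i - d) * fact (i - d) * fact (a - 1 - i)"
proof -
  have split: "{d..<a} - {i} = {d..<i} \<union> {Suc i..<a}" using assms by auto
  have "(\<Prod>j\<in>{d..<i}. real j - real i) = (\<Prod>t\<in>{1..i - d}. - real t)"
    by (rule prod.reindex_bij_witness[where i = "\<lambda>t. i - t" and j = "\<lambda>j. i - j"]) (auto simp: of_nat_diff)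
  also have "\<dots> = (- 1) ^ (i - d) * fact (i - d)"
    by (simp add: prod_uminus fact_prod)
  finally have 1: "(\<Prod>j\<in>{d..<i}. real j - real i) = (- 1) ^ (i - d) * fact (i - d)" .
  have 2: "(\<Prod>j\<in>{Suc i..<a}. real j - real i) = (\<Prod>t\<in>{1..a - 1 - i}. real t)"
    by (rule prod.reindex_bij_witness[where i = "\<lambda>t. i + t" and j = "\<lambda>j. j - i"]) (auto simp: of_nat_diff)
  show ?thesis
    unfolding split by (subst prod.union_disjoint) (auto simp: 1 2 fact_prod)
qed

lemma prod_shifted_eq_fact:
  assumes "0 < d" "d \<le> a"
  shows "(\<Prod>i=d..<a. real l + real i) = fact (l + a - 1) / fact (l + d - 1)"
  using assms(2)
proof (induction a rule: dec_induct)
  case (step a)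
  have "fact (l + Suc a - 1) = (real l + real a) * fact (l + a - 1)"
    using assms(1) step.hyps fact_reduce[of "l + a", where 'a=real] by simp
  then show ?case using step.IH step.hyps by simp
qed simp

text \<open>With m = a - 1 - d the alternating sum is the binomial expansion of (1 - s)^m, divided
  by m! and multiplied by a power of s. Hence the density is that of the Beta distribution with
  parameters l + d and a - d.\<close>

lemma w_density_eq:
  assumes d: "0 < d" and da: "d < a"
  shows "w_density d a l s =
    fact (l + a - 1) / (fact (l + d - 1) * fact (a - 1 - d)) * (s ^ (l + d - 1) * (1 - s) ^ (a - 1 - d))"
proof -
  define m where "m = a - 1 - d"
  have a: "a = d + m + 1" using da by (simp add: m_def)
  have "(\<Sum>i=d..<a. s ^ (i + l - 1) / (\<Prod>j\<in>{d..<a} - {i}. real j - real i)) =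
      (\<Sum>q\<le>m. s ^ (q + d + l - 1) / ((- 1) ^ q * fact q * fact (m - q)))"
    by (rule sum.reindex_bij_witness[where i = "\<lambda>q. q + d" and j = "\<lambda>i. i - d"])
       (auto simp: a prod_diff_remove add.commute)
  also have "\<dots> = (\<Sum>q\<le>m. s ^ (l + d - 1) / fact m * (of_nat (m choose q) * (- s) ^ q * 1 ^ (m - q)))"
  proof (rule sum.cong[OF refl])
    fix q assume "q \<in> {..m}"
    then have c: "real (m choose q) = fact m / (fact q * fact (m - q))"
      by (simp add: binomial_fact)
    have "q + d + l - 1 = q + (l + d - 1)" using d by simp
    then have "s ^ (q + d + l - 1) = s ^ q * s ^ (l + d - 1)"
      by (simp only: power_add)
    moreover have "(- s) ^ q = (- 1) ^ q * s ^ q" by (rule power_minus)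
    moreover have "inverse ((- 1) ^ q :: real) = (- 1) ^ q"
      by (simp add: power_inverse[symmetric])
    ultimately show "s ^ (q + d + l - 1) / ((- 1) ^ q * fact q * fact (m - q)) =
        s ^ (l + d - 1) / fact m * (of_nat (m choose q) * (- s) ^ q * 1 ^ (m - q))"
      by (simp add: c field_simps)
  qed
  also have "\<dots> = s ^ (l + d - 1) / fact m * (- s + 1) ^ m"
    unfolding binomial_ring by (simp add: sum_distrib_left)
  finally show ?thesis
    unfolding w_density_def m_def[symmetric] using prod_shifted_eq_fact[of d a l] d da by simp
qed

lemma nn_integral_beta_nat:
  "(\<integral>\<^sup>+s. ennreal (s ^ n * (1 - s) ^ m) * indicator {0..1} s \<partial>lborel) =
    ennreal (fact n * fact m / fact (n + m + 1))"
proof -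
  have "((\<lambda>t::real. t powr (real (Suc n) - 1) * (1 - t) powr (real (Suc m) - 1))
      has_integral Beta (real (Suc n)) (real (Suc m))) {0..1}"
    by (rule has_integral_Beta_real) auto
  from nn_integral_has_integral_lebesgue[OF _ this]
  have "(\<integral>\<^sup>+t. ennreal (indicator {0..1} t * (t powr (real (Suc n) - 1) * (1 - t) powr (real (Suc m) - 1))) \<partial>lborel) =
      ennreal (Beta (real (Suc n)) (real (Suc m)))" by simp
  \<comment> \<open>The endpoints have to be excluded: \<open>0 powr 0\<close> is 0 whereas
    \<open>0 ^ 0\<close> is 1.\<close>
  moreover have "(\<integral>\<^sup>+s. ennreal (s ^ n * (1 - s) ^ m) * indicator {0..1} s \<partial>lborel) =
      (\<integral>\<^sup>+t. ennreal (indicator {0..1} t * (t powr (real (Suc n) - 1) * (1 - t) powr (real (Suc m) - 1))) \<partial>lborel)"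
    by (rule nn_integral_cong_AE, rule AE_mp[OF AE_lborel_singleton[of 0]], rule AE_mp[OF AE_lborel_singleton[of 1]])
       (auto simp: powr_realpow indicator_def)
  moreover have "Beta (real (Suc n)) (real (Suc m)) = fact n * fact m / fact (n + m + 1)"
    using Gamma_fact[of n, where 'a=real] Gamma_fact[of m, where 'a=real] Gamma_fact[of "n + m + 1", where 'a=real]
    by (simp add: Beta_def add_ac)
  ultimately show ?thesis by simp
qed

definition radial_measure :: "nat \<Rightarrow> nat \<Rightarrow> nat \<Rightarrow> real measure" where
  "radial_measure d a l = (if a = d then return borel 1
     else density lborel (\<lambda>s. ennreal (w_density d a l s) * indicator {0..1} s))"

lemma sets_radial_measure [measurable_cong, simp]: "sets (radial_measure d a l) = sets borel"
  by (simp add: radial_measure_def)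

text \<open>Not visible in the defining alternating sum, but immediate from the product
  form.\<close>

lemma w_density_nonneg:
  assumes "0 < d" "d < a" "0 \<le> s" "s \<le> 1"
  shows "0 \<le> w_density d a l s"
  using assms by (simp add: w_density_eq)

lemma w_density_measurable [measurable]: "w_density d a l \<in> borel_measurable borel"
  unfolding w_density_def by measurable

text \<open>Multiplying the Beta density by s^k raises its first parameter by k, so the moment is a
  quotient of two Beta integrals. For a = d the right-hand side is 1, in agreement with the point
  mass.\<close>

lemma radial_moment:
  assumes d: "0 < d" and da: "d \<le> a"
  shows "(\<integral>\<^sup>+s. ennreal (s ^ k) * indicator {0..1} s \<partial>radial_measure d a l) =
    ennreal (fact (l + a - 1) * fact (l + k + d - 1) / (fact (l + d - 1) * fact (l + k + a - 1)))"
proof (cases "a = d")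
  case True
  then show ?thesis by (simp add: radial_measure_def nn_integral_return)
next
  case False
  then have lt: "d < a" using da by simp
  define m where "m = a - 1 - d"
  define c where "c = fact (l + a - 1) / (fact (l + d - 1) * fact m :: real)"
  have c: "0 \<le> c" by (simp add: c_def)
  have "(\<integral>\<^sup>+s. ennreal (s ^ k) * indicator {0..1} s \<partial>radial_measure d a l) =
      (\<integral>\<^sup>+s. ennreal (w_density d a l s) * indicator {0..1} s * (ennreal (s ^ k) * indicator {0..1} s) \<partial>lborel)"
    using False by (simp add: radial_measure_def nn_integral_density)
  also have "\<dots> = (\<integral>\<^sup>+s. ennreal c * (ennreal (s ^ (l + k + d - 1) * (1 - s) ^ m) * indicator {0..1} s) \<partial>lborel)"
  proof (rule nn_integral_cong)
    fix s :: real
    have "w_density d a l s * s ^ k = c * (s ^ (l + k + d - 1) * (1 - s) ^ m)"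
    proof -
      have "s ^ (l + d - 1) * s ^ k = s ^ (l + k + d - 1)"
        using d by (simp add: power_add[symmetric] add_ac)
      then show ?thesis
        unfolding w_density_eq[OF d lt] m_def[symmetric] c_def[symmetric]
        by (metis (no_types, lifting) mult.assoc mult.commute)
    qed
    then show "ennreal (w_density d a l s) * indicator {0..1} s * (ennreal (s ^ k) * indicator {0..1} s) =
        ennreal c * (ennreal (s ^ (l + k + d - 1) * (1 - s) ^ m) * indicator {0..1} s)"
      using c d lt w_density_nonneg[of d a s l]
      by (cases "s \<in> {0..1}") (auto simp: ennreal_mult[symmetric])
  qed
  also have "\<dots> = ennreal (c * (fact (l + k + d - 1) * fact m / fact (l + k + d - 1 + m + 1)))"
    using c by (subst nn_integral_cmult, measurable) (simp only: nn_integral_beta_nat ennreal_mult')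
  also have "l + k + d - 1 + m + 1 = l + k + a - 1"
    using d lt by (simp add: m_def)
  also have "c * (fact (l + k + d - 1) * fact m / fact (l + k + a - 1)) =
      fact (l + a - 1) * fact (l + k + d - 1) / (fact (l + d - 1) * fact (l + k + a - 1))"
    by (simp add: c_def)
  finally show ?thesis .
qed

lemma AE_radial_measure: "AE s in radial_measure d a l. s \<in> {0..1}"
proof (cases "a = d")
  case True
  show ?thesis unfolding radial_measure_def if_P[OF True] by (subst AE_return) auto
next
  case False
  show ?thesis unfolding radial_measure_def if_not_P[OF False]
    by (subst AE_density, measurable) (auto simp: indicator_def)
qed

lemma prob_space_radial_measure:
  assumes "0 < d" "d \<le> a"
  shows "prob_space (radial_measure d a l)"
proof
  have "emeasure (radial_measure d a l) (space (radial_measure d a l)) = (\<integral>\<^sup>+s. 1 \<partial>radial_measure d a l)"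
    by simp
  also have "\<dots> = (\<integral>\<^sup>+s. ennreal (s ^ 0) * indicator {0..1} s \<partial>radial_measure d a l)"
    by (rule nn_integral_cong_AE, rule AE_mp[OF AE_radial_measure]) auto
  also have "\<dots> = 1"
    unfolding radial_moment[OF assms] by simp
  finally show "emeasure (radial_measure d a l) (space (radial_measure d a l)) = 1" .
qed

definition spherical_measure :: "('n::finite \<Rightarrow> nat) \<Rightarrow> (complex ^ 'n) measure" where
  "spherical_measure \<delta> = density sphere_measure
     (\<lambda>z. ennreal ((cmod (zpow z \<delta>))\<^sup>2 / (\<integral>y. (cmod (zpow y \<delta>))\<^sup>2 \<partial>sphere_measure)))"

lemma sets_spherical_measure [measurable_cong, simp]: "sets (spherical_measure \<delta>) = sets borel"
  by (simp add: spherical_measure_def)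

lemma spherical_measure_eq:
  "spherical_measure \<delta> = density sphere_measure (\<lambda>z. ennreal ((cmod (zpow z \<delta>))\<^sup>2 / sphere_moment \<delta>))"
proof -
  have "(\<integral>y. (cmod (zpow y \<delta>))\<^sup>2 \<partial>sphere_measure) = sphere_moment \<delta>"
    by (subst integral_eq_nn_integral)
       (auto simp: nn_integral_sphere_zpow less_imp_le[OF sphere_moment_pos])
  then show ?thesis by (simp add: spherical_measure_def)
qed

text \<open>Monomials multiply by adding exponents, so moments of the weighted measure are ratios of
  moments of the surface measure.\<close>

lemma spherical_moment:
  "(\<integral>\<^sup>+z. ennreal ((cmod (zpow z \<alpha>))\<^sup>2) \<partial>spherical_measure \<delta>) =
    ennreal (sphere_moment (\<lambda>j. \<delta> j + \<alpha> j) / sphere_moment \<delta>)"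
proof -
  have "(\<integral>\<^sup>+z. ennreal ((cmod (zpow z \<alpha>))\<^sup>2) \<partial>spherical_measure \<delta>) =
      (\<integral>\<^sup>+z. ennreal ((cmod (zpow z \<delta>))\<^sup>2 / sphere_moment \<delta>) * ennreal ((cmod (zpow z \<alpha>))\<^sup>2) \<partial>sphere_measure)"
    unfolding spherical_measure_eq by (rule nn_integral_density) measurable
  also have "\<dots> = (\<integral>\<^sup>+z. ennreal (1 / sphere_moment \<delta>) * ennreal ((cmod (zpow z (\<lambda>j. \<delta> j + \<alpha> j)))\<^sup>2) \<partial>sphere_measure)"
    using less_imp_le[OF sphere_moment_pos[of \<delta>]]
    by (intro nn_integral_cong) (simp add: ennreal_mult[symmetric] zpow_add norm_mult power_mult_distrib)
  also have "\<dots> = ennreal (1 / sphere_moment \<delta>) * ennreal (sphere_moment (\<lambda>j. \<delta> j + \<alpha> j))"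
    by (simp add: nn_integral_cmult nn_integral_sphere_zpow)
  finally show ?thesis
    using less_imp_le[OF sphere_moment_pos[of "\<lambda>j. \<delta> j + \<alpha> j"]] by (simp add: ennreal_mult''[symmetric])
qed

lemma AE_spherical_measure: "AE z in spherical_measure \<delta>. z \<in> sphere 0 1"
  unfolding spherical_measure_def
  by (subst AE_density, measurable) (rule AE_mp[OF AE_sphere_measure], auto)

lemma prob_space_spherical_measure: "prob_space (spherical_measure \<delta>)"
proof
  have "emeasure (spherical_measure \<delta>) (space (spherical_measure \<delta>)) =
      (\<integral>\<^sup>+z. ennreal ((cmod (zpow z (\<lambda>_. 0)))\<^sup>2) \<partial>spherical_measure \<delta>)"
    by (simp add: zpow_def)
  also have "\<dots> = 1"
    unfolding spherical_moment using sphere_moment_pos[of \<delta>] by simp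
  finally show "emeasure (spherical_measure \<delta>) (space (spherical_measure \<delta>)) = 1" .
qed

section \<open>The operator measure\<close>

lemma measurable_monomial_weight:
  "(\<lambda>p. ennreal (fst p ^ mabs \<alpha> * (cmod (zpow (snd p) \<alpha>))\<^sup>2) *
    indicator ({0..1} \<times> sphere 0 1) (p :: real \<times> (complex ^ 'n::finite))) \<in> borel_measurable borel"
proof -
  have S: "{0..1} \<times> sphere 0 1 \<in> sets (borel :: (real \<times> (complex ^ 'n)) measure)"
    by (intro borel_closed closed_Times) auto
  have "(\<lambda>p. (fst p :: real) ^ mabs \<alpha> * (cmod (zpow (snd p) \<alpha>))\<^sup>2) \<in> borel_measurable borel"
    unfolding zpow_def by (intro borel_measurable_continuous_onI continuous_intros)
  then show ?thesis
    using S by (intro borel_measurable_times_ennreal measurable_compose[OF _ measurable_ennreal] borel_measurable_indicator) auto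
qed

locale da_tree_product = tree_product T a for T :: "'n::finite \<Rightarrow> 'v digraph" and a :: nat +
  assumes card_le: "CARD('n) \<le> a"
begin

section \<open>Product measures attached to depths\<close>

definition node_measure :: "('n \<Rightarrow> nat) \<Rightarrow> (real \<times> (complex ^ 'n)) measure" where
  "node_measure \<delta> = radial_measure CARD('n) a (mabs \<delta>) \<Otimes>\<^sub>M spherical_measure \<delta>"

lemma sets_node_measure [simp, measurable_cong]: "sets (node_measure \<delta>) = sets borel"
proof -
  have "sets (node_measure \<delta>) = sets (borel \<Otimes>\<^sub>M borel)"
    unfolding node_measure_def by (rule sets_pair_measure_cong) simp_all
  then show ?thesis by (simp only: borel_prod)
qed

lemma prob_radial: "prob_space (radial_measure CARD('n) a l)"
  using card_le by (intro prob_space_radial_measure) auto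

lemma prob_space_node_measure: "prob_space (node_measure \<delta>)"
proof -
  interpret M1: prob_space "radial_measure CARD('n) a (mabs \<delta>)" by (rule prob_radial)
  interpret M2: prob_space "spherical_measure \<delta>" by (rule prob_space_spherical_measure)
  interpret pair_prob_space "radial_measure CARD('n) a (mabs \<delta>)" "spherical_measure \<delta>" ..
  show ?thesis unfolding node_measure_def by unfold_locales
qed

lemma measure_node_le_one: "\<bar>measure (node_measure \<delta>) \<Delta>\<bar> \<le> 1"
proof -
  interpret prob_space "node_measure \<delta>" by (rule prob_space_node_measure)
  show ?thesis by simp
qed

lemma measure_node_support:
  "measure (node_measure \<delta>) (- ({0..1} \<times> sphere 0 1)) = 0"
proof -
  interpret M1: prob_space "radial_measure CARD('n) a (mabs \<delta>)" by (rule prob_radial)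
  interpret M2: prob_space "spherical_measure \<delta>" by (rule prob_space_spherical_measure)
  interpret N: prob_space "node_measure \<delta>" by (rule prob_space_node_measure)
  have "emeasure (radial_measure CARD('n) a (mabs \<delta>)) {0..1} = 1"
    using AE_radial_measure by (intro M1.emeasure_eq_1_AE) auto
  moreover have "emeasure (spherical_measure \<delta>) (sphere 0 1) = 1"
    using AE_spherical_measure by (intro M2.emeasure_eq_1_AE) auto
  ultimately have "emeasure (node_measure \<delta>) ({0..1} \<times> sphere 0 1) = 1"
    unfolding node_measure_def by (subst M2.emeasure_pair_measure_Times) auto
  then have "N.prob ({0..1} \<times> sphere 0 1) = 1" by (simp add: measure_def)
  moreover have sp: "space (node_measure \<delta>) = UNIV"
    using sets_eq_imp_space_eq[OF sets_node_measure] by simp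
  moreover have "{0..1} \<times> sphere 0 1 \<in> sets (borel :: (real \<times> (complex ^ 'n)) measure)"
    by (intro borel_closed closed_Times) auto
  ultimately show ?thesis
    using N.prob_compl[of "{0..1} \<times> sphere 0 1"] by (simp add: Compl_eq_Diff_UNIV)
qed

text \<open>The factorials containing \<open>CARD('n)\<close> in the radial moment cancel those in
  the spherical moment; only factorials containing \<open>a\<close> survive, and they form the
  quotient of \<open>depth_weight\<close>.\<close>

lemma node_moment:
  "(\<integral>\<^sup>+p\<in>{0..1} \<times> sphere 0 1. ennreal (fst p ^ mabs \<alpha> * (cmod (zpow (snd p) \<alpha>))\<^sup>2) \<partial>node_measure \<delta>) =
    ennreal (depth_weight a (\<lambda>j. \<delta> j + \<alpha> j) / depth_weight a \<delta>)"
proof -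
  let ?R = "radial_measure CARD('n) a (mabs \<delta>)" and ?Z = "spherical_measure \<delta>"
  let ?f = "\<lambda>p. ennreal (fst p ^ mabs \<alpha> * (cmod (zpow (snd p) \<alpha>))\<^sup>2) *
    indicator ({0..1} \<times> sphere 0 1) (p :: real \<times> (complex ^ 'n))"
  interpret M2: prob_space ?Z by (rule prob_space_spherical_measure)
  have f: "?f \<in> borel_measurable (?R \<Otimes>\<^sub>M ?Z)"
    by (subst measurable_cong_sets[OF sets_node_measure[unfolded node_measure_def] refl])
       (rule measurable_monomial_weight)
  have "(\<integral>\<^sup>+p. ?f p \<partial>node_measure \<delta>) = (\<integral>\<^sup>+s. \<integral>\<^sup>+z. ?f (s, z) \<partial>?Z \<partial>?R)"
    unfolding node_measure_def by (rule M2.nn_integral_fst[OF f, symmetric])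
  also have "\<dots> = (\<integral>\<^sup>+s. ennreal (s ^ mabs \<alpha>) * indicator {0..1} s *
      ennreal (sphere_moment (\<lambda>j. \<delta> j + \<alpha> j) / sphere_moment \<delta>) \<partial>?R)"
  proof (rule nn_integral_cong)
    fix s :: real
    have "(\<integral>\<^sup>+z. ?f (s, z) \<partial>?Z) =
        (\<integral>\<^sup>+z. ennreal (s ^ mabs \<alpha>) * indicator {0..1} s * ennreal ((cmod (zpow z \<alpha>))\<^sup>2) \<partial>?Z)"
      by (rule nn_integral_cong_AE, rule AE_mp[OF AE_spherical_measure])
         (auto simp: indicator_def ennreal_mult'')
    also have "\<dots> = ennreal (s ^ mabs \<alpha>) * indicator {0..1} s *
        ennreal (sphere_moment (\<lambda>j. \<delta> j + \<alpha> j) / sphere_moment \<delta>)"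
      by (subst nn_integral_cmult) (simp_all add: spherical_moment)
    finally show "(\<integral>\<^sup>+z. ?f (s, z) \<partial>?Z) = ennreal (s ^ mabs \<alpha>) * indicator {0..1} s *
        ennreal (sphere_moment (\<lambda>j. \<delta> j + \<alpha> j) / sphere_moment \<delta>)" .
  qed
  also have "\<dots> = (\<integral>\<^sup>+s. ennreal (s ^ mabs \<alpha>) * indicator {0..1} s \<partial>?R) *
      ennreal (sphere_moment (\<lambda>j. \<delta> j + \<alpha> j) / sphere_moment \<delta>)"
    by (rule nn_integral_multc) measurable
  also have "\<dots> = ennreal (fact (mabs \<delta> + a - 1) * fact (mabs \<delta> + mabs \<alpha> + CARD('n) - 1) /
        (fact (mabs \<delta> + CARD('n) - 1) * fact (mabs \<delta> + mabs \<alpha> + a - 1)) *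
      (sphere_moment (\<lambda>j. \<delta> j + \<alpha> j) / sphere_moment \<delta>))"
    using card_le by (subst radial_moment, simp, simp, intro ennreal_mult'[symmetric]) simp
  also have "fact (mabs \<delta> + a - 1) * fact (mabs \<delta> + mabs \<alpha> + CARD('n) - 1) /
        (fact (mabs \<delta> + CARD('n) - 1) * fact (mabs \<delta> + mabs \<alpha> + a - 1)) *
      (sphere_moment (\<lambda>j. \<delta> j + \<alpha> j) / sphere_moment \<delta>) =
      depth_weight a (\<lambda>j. \<delta> j + \<alpha> j) / depth_weight a \<delta>"
    unfolding sphere_moment_def depth_weight_def mabs_add by simp
  finally show ?thesis .
qed

definition model_measure ::
  "(real \<times> (complex ^ 'n)) set \<Rightarrow> (('n \<Rightarrow> 'v) \<Rightarrow> complex) \<Rightarrow> ('n \<Rightarrow> 'v) \<Rightarrow> complex" where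
  "model_measure \<Delta> f = (\<lambda>v. complex_of_real (measure (node_measure (mdepth T v)) \<Delta>) * f v)"

lemma model_measure_cmod_le: "cmod (model_measure \<Delta> f v) \<le> cmod (f v)"
  using mult_right_mono[OF measure_node_le_one[of "mdepth T v" \<Delta>] norm_ge_zero, of "f v"]
  by (simp add: model_measure_def norm_mult)

lemma node_weights_summable:
  assumes f: "f \<in> ell2 V"
  shows "(\<lambda>v. measure (node_measure (mdepth T v)) \<Delta> * (cmod (f v))\<^sup>2) summable_on V"
proof (rule summable_on_comparison_test)
  show "(\<lambda>v. (cmod (f v))\<^sup>2) summable_on V" using f by (simp add: ell2_def)
  show "measure (node_measure (mdepth T v)) \<Delta> * (cmod (f v))\<^sup>2 \<le> (cmod (f v))\<^sup>2" for v
    using measure_node_le_one[of "mdepth T v" \<Delta>] by (simp add: mult_left_le_one_le)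
qed simp

lemma model_measure_inner:
  assumes "f \<in> ell2 V"
  shows "ell2_inner V (model_measure \<Delta> f) f =
    complex_of_real (\<Sum>\<^sub>\<infinity>v\<in>V. measure (node_measure (mdepth T v)) \<Delta> * (cmod (f v))\<^sup>2)"
proof -
  have "model_measure \<Delta> f v * cnj (f v) =
      complex_of_real (measure (node_measure (mdepth T v)) \<Delta> * (cmod (f v))\<^sup>2)" for v
    by (simp add: model_measure_def mult.assoc complex_norm_square[symmetric])
  then show ?thesis
    unfolding ell2_inner_def
    using infsumI[OF has_sum_of_real[OF has_sum_infsum[OF node_weights_summable[OF assms]]]] by simp
qed

text \<open>Weak countable additivity is an exchange of the sums over vertices and over n. The
  double family is absolutely summable: at a vertex the measures of the disjoint sets add up to at
  most 1, so each row is dominated by the product of f and g there.\<close>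

lemma model_measure_sums:
  assumes f: "f \<in> ell2 V" and g: "g \<in> ell2 V"
    and A: "range A \<subseteq> sets borel" "disjoint_family A"
  shows "(\<lambda>n::nat. ell2_inner V (model_measure (A n) f) g) sums ell2_inner V (model_measure (\<Union>n. A n) f) g"
proof -
  let ?m = "\<lambda>v. measure (node_measure (mdepth T v))"
  let ?F = "\<lambda>(v, n). complex_of_real (?m v (A n)) * (f v * cnj (g v))"
  have m: "((\<lambda>n. ?m v (A n)) has_sum ?m v (\<Union>n. A n)) UNIV" for v
  proof -
    interpret prob_space "node_measure (mdepth T v)" by (rule prob_space_node_measure)
    show ?thesis
      using A by (intro sums_nonneg_imp_has_sum finite_measure_UNION) auto
  qed
  have row: "((\<lambda>n. ?F (v, n)) has_sum (model_measure (\<Union>n. A n) f v * cnj (g v))) UNIV" for v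
    using has_sum_cmult_left[OF has_sum_of_real[OF m[of v]], of "f v * cnj (g v)"]
    by (simp add: model_measure_def mult.assoc)
  have norm_row: "((\<lambda>n. norm (?F (v, n))) has_sum (?m v (\<Union>n. A n) * norm (f v * cnj (g v)))) UNIV" for v
    using has_sum_cmult_left[OF m[of v], of "norm (f v * cnj (g v))"] by (simp add: norm_mult)
  have fg: "(\<lambda>v. norm (f v * cnj (g v))) summable_on V"
    by (rule ell2_mult_abs_summable[OF f g])
  have "(\<lambda>p. norm (?F p)) summable_on V \<times> UNIV"
  proof (subst Infinite_Sum.abs_summable_on_Sigma_iff, intro conjI ballI)
    show "(\<lambda>n. norm (?F (v, n))) summable_on UNIV" for v
      using norm_row[of v] by (rule has_sum_imp_summable)
    show "(\<lambda>v. norm (\<Sum>\<^sub>\<infinity>n. norm (?F (v, n)))) summable_on V"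
    proof (rule Infinite_Sum.abs_summable_on_comparison_test'[OF fg])
      fix v
      have "(\<Sum>\<^sub>\<infinity>n. norm (?F (v, n))) = ?m v (\<Union>n. A n) * norm (f v * cnj (g v))"
        using norm_row[of v] by (rule infsumI)
      then show "norm (\<Sum>\<^sub>\<infinity>n. norm (?F (v, n))) \<le> norm (f v * cnj (g v))"
        using mult_right_mono[OF measure_node_le_one[of "mdepth T v" "\<Union>n. A n"] norm_ge_zero, of "f v * cnj (g v)"]
        by (simp add: abs_mult)
    qed
  qed
  then have "?F summable_on V \<times> UNIV" by (rule abs_summable_summable)
  then obtain S where S: "(?F has_sum S) (V \<times> UNIV)" by (auto simp: summable_on_def)
  have "((\<lambda>v. model_measure (\<Union>n. A n) f v * cnj (g v)) has_sum S) V"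
    using S row by (rule has_sum_SigmaD)
  then have S_eq: "S = ell2_inner V (model_measure (\<Union>n. A n) f) g"
    unfolding ell2_inner_def by (rule infsumI[symmetric])
  \<comment> \<open>The same double family, now with the vertices summed first.\<close>
  have "((\<lambda>(n, v). ?F (v, n)) has_sum S) (UNIV \<times> V)"
    using S by (subst has_sum_swap) simp
  moreover have "((\<lambda>v. (\<lambda>(n, v). ?F (v, n)) (n, v)) has_sum ell2_inner V (model_measure (A n) f) g) V" for n
  proof -
    have "model_measure (A n) f \<in> ell2 V"
      using f model_measure_cmod_le by (rule ell2_mono)
    from abs_summable_summable[OF ell2_mult_abs_summable[OF this g]]
    have "(\<lambda>v. model_measure (A n) f v * cnj (g v)) summable_on V" .
    then show ?thesis
      unfolding ell2_inner_def by (simp add: has_sum_infsum model_measure_def mult.assoc)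
  qed
  ultimately have "((\<lambda>n. ell2_inner V (model_measure (A n) f) g) has_sum S) UNIV"
    by (rule has_sum_SigmaD)
  then show ?thesis unfolding S_eq by (rule has_sum_imp_sums)
qed

lemma operator_measure_model: "operator_measure V E model_measure"
  unfolding operator_measure_def
proof (intro conjI ballI allI impI)
  fix \<Delta> :: "(real \<times> (complex ^ 'n)) set" and f
  assume f: "f \<in> E"
  then have l2: "f \<in> ell2 V" by (simp add: joint_kernel_iff)
  show "model_measure \<Delta> f \<in> E"
    unfolding model_measure_def using f measure_node_le_one
    by (rule joint_kernel_depth_mult[where m = "\<lambda>\<delta>. measure (node_measure \<delta>) \<Delta>"])
  show "ell2_inner V (model_measure \<Delta> f) f \<in> \<real>\<^sub>\<ge>\<^sub>0"
    unfolding model_measure_inner[OF l2] by (simp add: infsum_nonneg)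
  show "model_measure \<Delta> (\<lambda>x. c * f x + g x) = (\<lambda>x. c * model_measure \<Delta> f x + model_measure \<Delta> g x)" for c g
    by (simp add: model_measure_def fun_eq_iff algebra_simps)
next
  fix \<Delta> :: "(real \<times> (complex ^ 'n)) set"
  show "\<exists>C. \<forall>f\<in>E. ell2_norm V (model_measure \<Delta> f) \<le> C * ell2_norm V f"
    by (rule exI[of _ 1]) (auto simp: joint_kernel_iff intro!: ell2_norm_mono model_measure_cmod_le)
next
  fix A :: "nat \<Rightarrow> (real \<times> (complex ^ 'n)) set" and f g
  assume "range A \<subseteq> sets borel \<and> disjoint_family A" "f \<in> E" "g \<in> E"
  then show "(\<lambda>n. ell2_inner V (model_measure (A n) f) g) sums ell2_inner V (model_measure (\<Union>n. A n) f) g"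
    by (intro model_measure_sums) (auto simp: joint_kernel_iff)
qed

text \<open>The monadic bind over an empty space is a default value; this rules that case
  out.\<close>

lemma V_nonempty: "V \<noteq> {}"
proof -
  have "droot T \<in> V" by (simp add: verts_dprod droot_def tree_root(1)[OF tree])
  then show ?thesis by auto
qed

text \<open>The quadratic measure is a mixture of the measures of the nodes \<open>v\<close> with weights \<open>\<bar>f v\<bar>\<^sup>2\<close>,
  so integrals against it can be computed with the Giry monad.\<close>

lemma nn_integral_quadratic_measure:
  assumes f: "f \<in> ell2 V" and h: "h \<in> borel_measurable borel"
  shows "(\<integral>\<^sup>+p. h p \<partial>quadratic_measure V model_measure f) =
    (\<integral>\<^sup>+v. ennreal ((cmod (f v))\<^sup>2) * (\<integral>\<^sup>+p. h p \<partial>node_measure (mdepth T v)) \<partial>count_space V)"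
proof -
  \<comment> \<open>The mixing measure has total mass the squared norm of f and need not be a
    probability; the bind asks only that each \<open>N v\<close> be a subprobability
    measure.\<close>
  define K where "K = density (count_space V) (\<lambda>v. ennreal ((cmod (f v))\<^sup>2))"
  define N where "N = (\<lambda>v. node_measure (mdepth T v))"
  have space_K: "space K \<noteq> {}" using V_nonempty by (simp add: K_def)
  have "N \<in> count_space V \<rightarrow>\<^sub>M subprob_algebra borel"
    using prob_space_imp_subprob_space[OF prob_space_node_measure]
    by (auto simp: N_def space_subprob_algebra)
  then have N: "N \<in> K \<rightarrow>\<^sub>M subprob_algebra borel"
    by (subst measurable_cong_sets[of K "count_space V"]) (simp_all add: K_def)
  have emeasure_eq: "emeasure (K \<bind> N) \<Delta> = ennreal (Re (ell2_inner V (model_measure \<Delta> f) f))"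
    if \<Delta>: "\<Delta> \<in> sets borel" for \<Delta>
  proof -
    have "emeasure (K \<bind> N) \<Delta> = (\<integral>\<^sup>+v. ennreal ((cmod (f v))\<^sup>2) * emeasure (N v) \<Delta> \<partial>count_space V)"
      by (subst emeasure_bind[OF space_K N \<Delta>]) (simp add: K_def nn_integral_density)
    also have "\<dots> = (\<integral>\<^sup>+v. ennreal (measure (node_measure (mdepth T v)) \<Delta> * (cmod (f v))\<^sup>2) \<partial>count_space V)"
    proof (rule nn_integral_cong)
      fix v
      interpret prob_space "node_measure (mdepth T v)" by (rule prob_space_node_measure)
      show "ennreal ((cmod (f v))\<^sup>2) * emeasure (N v) \<Delta> =
          ennreal (measure (node_measure (mdepth T v)) \<Delta> * (cmod (f v))\<^sup>2)"
        by (simp add: N_def emeasure_eq_measure ennreal_mult mult.commute)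
    qed
    also have "\<dots> = ennreal (\<Sum>\<^sub>\<infinity>v\<in>V. measure (node_measure (mdepth T v)) \<Delta> * (cmod (f v))\<^sup>2)"
      using node_weights_summable[OF f] by (rule nn_integral_eq_infsum) simp
    finally show ?thesis by (simp add: model_measure_inner[OF f])
  qed
  have sets: "sets (K \<bind> N) = sets borel"
    by (rule sets_bind[OF _ space_K]) (simp add: N_def)
  \<comment> \<open>\<open>measure_of\<close> gives the zero measure unless the set function is
    countably additive. Agreement with \<open>emeasure\<close> of the bind on all Borel sets secures
    this.\<close>
  have "quadratic_measure V model_measure f = measure_of UNIV (sets borel) (emeasure (K \<bind> N))"
    unfolding quadratic_measure_def
    by (rule measure_of_eq) (simp_all add: emeasure_eq sets.sigma_sets_eq[of borel, simplified])
  also have "\<dots> = K \<bind> N"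
    using measure_of_of_measure[of "K \<bind> N"] sets sets_eq_imp_space_eq[OF sets] by simp
  finally have "(\<integral>\<^sup>+p. h p \<partial>quadratic_measure V model_measure f) = (\<integral>\<^sup>+v. \<integral>\<^sup>+p. h p \<partial>N v \<partial>K)"
    using nn_integral_bind[OF h N] by simp
  then show ?thesis
    unfolding K_def N_def by (simp add: nn_integral_density)
qed

lemma representing_measure_model:
  assumes \<Omega>: "\<And>F. \<Omega> F \<subseteq> Phi T F"
  shows "representing_measure T (real a) \<Omega> 1 model_measure
    (\<lambda>u. radial_measure CARD('n) a (mabs (mdepth T u))) (\<lambda>u. spherical_measure (mdepth T u))"
  unfolding representing_measure_def
proof (intro conjI ballI allI impI)
  show "(0::real) < 1" by simp
  show "operator_measure V E model_measure" by (rule operator_measure_model)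
  show "model_measure (- ({0..1} \<times> sphere 0 1)) f = (\<lambda>_. 0)" for f
    by (simp add: model_measure_def measure_node_support)
next
  fix u
  let ?R = "radial_measure CARD('n) a (mabs (mdepth T u))" and ?Z = "spherical_measure (mdepth T u)"
  interpret R: prob_space ?R by (rule prob_radial)
  interpret Z: prob_space ?Z by (rule prob_space_spherical_measure)
  show "finite_measure ?R" "finite_measure ?Z" by unfold_locales
  show "sets ?R = sets borel" "sets ?Z = sets borel" by simp_all
  show "emeasure ?R (- {0..1}) = 0"
    using AE_iff_measurable[of "- {0..1}" ?R "\<lambda>s. s \<in> {0..1}"] AE_radial_measure[of "CARD('n)" a "mabs (mdepth T u)"]
      sets_eq_imp_space_eq[OF sets_radial_measure[of "CARD('n)" a "mabs (mdepth T u)"]]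
    by (auto simp: Compl_eq)
  show "emeasure ?Z (- sphere 0 1) = 0"
    using AE_iff_measurable[of "- sphere 0 1" ?Z "\<lambda>z. z \<in> sphere 0 1"] AE_spherical_measure[of "mdepth T u"]
      sets_eq_imp_space_eq[OF sets_spherical_measure[of "mdepth T u"]]
    by (auto simp: Compl_eq)
next
  fix f \<alpha>
  assume f: "f \<in> E"
  show "tuple_power Mz \<alpha> (const_series f) \<in> model_space T (real a)"
    using f by (rule model_monomial)
  let ?h = "\<lambda>p. ennreal (fst p ^ mabs \<alpha> * (cmod (zpow (snd p) \<alpha>))\<^sup>2) *
    indicator ({0..1} \<times> sphere 0 1) (p :: real \<times> (complex ^ 'n))"
  note h = measurable_monomial_weight[of \<alpha>]
  have "f \<in> ell2 V" using f by (simp add: joint_kernel_iff)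
  from nn_integral_quadratic_measure[OF this h]
  have "(\<integral>\<^sup>+p. ?h p \<partial>quadratic_measure V model_measure f) =
      (\<integral>\<^sup>+v. ennreal ((cmod (f v))\<^sup>2) *
        ennreal (depth_weight a (\<lambda>j. mdepth T v j + \<alpha> j) / depth_weight a (mdepth T v)) \<partial>count_space V)"
    unfolding node_moment .
  also have "\<dots> = (\<integral>\<^sup>+v. ennreal (depth_weight a (\<lambda>j. mdepth T v j + \<alpha> j) / depth_weight a (mdepth T v) *
        (cmod (f v))\<^sup>2) \<partial>count_space V)"
    by (intro nn_integral_cong, subst mult.commute, intro ennreal_mult''[symmetric]) simp
  finally show "ennreal ((model_norm T (real a) (tuple_power Mz \<alpha> (const_series f)))\<^sup>2) =
      (\<integral>\<^sup>+p. ?h p \<partial>quadratic_measure V model_measure f)"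
    using model_monomial(2)[OF f] by simp
next
  fix \<Delta> :: "(real \<times> (complex ^ 'n)) set" and g
  assume g: "(\<forall>F. \<forall>u\<in>\<Omega> F. g F u \<in> Lspace T (real a) u F) \<and> (\<lambda>x. \<Sum>F\<in>UNIV. \<Sum>\<^sub>\<infinity>u\<in>\<Omega> F. g F u x) \<in> E"
  let ?m = "\<lambda>u. complex_of_real (measure (radial_measure CARD('n) a (mabs (mdepth T u)) \<Otimes>\<^sub>M spherical_measure (mdepth T u)) \<Delta>)"
  \<comment> \<open>Where \<open>g F u x\<close> is nonzero, x lies in the sibling class of u and
    has the same depth. The scalar can thus be evaluated at x instead of u and taken out of the sum
    over u.\<close>
  have eq: "?m u * g F u x = ?m x * g F u x" if "u \<in> \<Omega> F" for F u x
  proof (cases "x \<in> sibF T F u")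
    case True
    moreover have "u \<in> Phi T F" using \<Omega> that by auto
    ultimately show ?thesis using mdepth_sibF by simp
  next
    case False
    have "g F u \<in> ell2 (sibF T F u)" using g that by (auto simp: Lspace_def)
    then show ?thesis using False by (simp add: ell2_def)
  qed
  have "(\<Sum>\<^sub>\<infinity>u\<in>\<Omega> F. ?m u * g F u x) = ?m x * (\<Sum>\<^sub>\<infinity>u\<in>\<Omega> F. g F u x)" for F x
    by (subst infsum_cmult_right'[symmetric], rule infsum_cong) (rule eq)
  then show "model_measure \<Delta> (\<lambda>x. \<Sum>F\<in>UNIV. \<Sum>\<^sub>\<infinity>u\<in>\<Omega> F. g F u x) =
      (\<lambda>x. \<Sum>F\<in>UNIV. \<Sum>\<^sub>\<infinity>u\<in>\<Omega> F. ?m u * g F u x)"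
    by (simp add: model_measure_def node_measure_def sum_distrib_left)
next
  show "prob_space (radial_measure CARD('n) a (mabs (mdepth T (droot T))))" by (rule prob_radial)
  show "prob_space (spherical_measure (mdepth T (droot T)))" by (rule prob_space_spherical_measure)
qed

end

theorem corollary2p17:
  fixes T :: "'n::finite \<Rightarrow> 'v digraph"
    and \<Omega> :: "'n set \<Rightarrow> ('n \<Rightarrow> 'v) set"
    and a :: nat
  assumes trees: "\<And>j. rooted_directed_tree (T j)"
    and countably_infinite: "\<And>j. countable (verts (T j)) \<and> infinite (verts (T j))"
    and leafless: "\<And>j. leafless (T j)"
    and locally_finite: "\<And>j. locally_finite (T j)"
    and branching: "finite_joint_branching_index T"
    and \<Omega>: "transversals T \<Omega>"
    and a_pos: "0 < a"
    and a_ge_d: "CARD('n) \<le> a"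
  shows "\<exists>b \<mu> \<rho> \<nu>.
    representing_measure T (real a) \<Omega> b \<mu> \<rho> \<nu> \<and>
    (\<forall>F. \<forall>u\<in>\<Omega> F.
       (CARD('n) < a \<longrightarrow>
          (\<forall>s\<in>{0..1}. 0 \<le> w_density CARD('n) a (mabs (mdepth T u)) s) \<and>
          \<rho> u = density lborel
            (\<lambda>s. ennreal (w_density CARD('n) a (mabs (mdepth T u)) s) * indicator {0..1} s)) \<and>
       (a = CARD('n) \<longrightarrow> \<rho> u = return borel 1) \<and>
       \<nu> u = density sphere_measure
         (\<lambda>z. ennreal ((cmod (zpow z (mdepth T u)))\<^sup>2 /
            (\<integral>y. (cmod (zpow y (mdepth T u)))\<^sup>2 \<partial>sphere_measure))))"
proof -
  interpret da_tree_product T a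
    by unfold_locales (fact trees leafless locally_finite a_pos a_ge_d)+
  have "\<Omega> F \<subseteq> Phi T F" for F
    using \<Omega> by (auto simp: transversals_def)
  then have "representing_measure T (real a) \<Omega> 1 model_measure
      (\<lambda>u. radial_measure CARD('n) a (mabs (mdepth T u))) (\<lambda>u. spherical_measure (mdepth T u))"
    by (rule representing_measure_model)
  moreover have "0 \<le> w_density CARD('n) a l s" if "CARD('n) < a" "s \<in> {0..1}" for l s
    using that by (intro w_density_nonneg) auto
  ultimately show ?thesis
    by (intro exI conjI) (auto simp: radial_measure_def spherical_measure_def)
qed

end
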